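(* Let $\nu>0$, $L>0$, $T>0$, and let $f(x,t)$ be a smooth vector field, $L$-periodic in each coordinate with zero spatial mean. Let $u(x,t)$ be a smooth divergence-free $L$-periodic vector field on $\mathbb{R}^3\times[0,T]$ such that for every $t\in[0,T]$ $$\int|u(x,t)|^2dx+\nu\int_0^t\!\!\int|\nabla u(x,s)|^2dxds\le K_0(t),$$ where $K_0(t)=\min\{k_0(t),k_1(t)\}$, $$k_0(t)=2\int|u(x,0)|^2dx+3t\int_0^t\!\!\int|f(x,s)|^2dxds,\qquad k_1(t)=\int|u(x,0)|^2dx+\frac1\nu\int_0^t\!\!\int|(-\Delta)^{-1/2}f(x,s)|^2dxds,$$ and such that $\int_0^T\|u(\cdot,s)\|_{L^\infty}ds\le K_\infty$ for a constant $K_\infty$. Let $\ell$ be a smooth $L$-periodic vector field solving $$(\partial_t+u\cdot\nabla-\nu\Delta)\ell+u=0,\qquad \ell(x,0)=0.$$ Then there is a universal constant $C>0$ such that for all $t\in(0,T]$: $$\|\ell(\cdot,t)\|_{L^\infty}\le\int_0^t\|u(\cdot,s)\|_{L^\infty}ds\le K_\infty,$$ $$\frac1{L^3}\int|\ell(x,t)|^2dx\le(4E_0+t\epsilon_B)t^2,$$ $$\frac1{L^3t}\int_0^t\!\!\int|\nabla\ell(x,s)|^2dxds\le\frac{Bt}{2\nu},$$ $$\int|\nabla\ell(x,t)|^2\frac{dx}{L^3}+\nu\int_0^t\!\!\int|\Delta\ell(x,s)|^2\frac{dx}{L^3}ds\le C\Big(\frac{Bt}{\nu}+\frac{K_\infty^2B}{\nu^2}\Big),$$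 where $E_0=\frac1{2L^3}\int|u(x,0)|^2dx$, $\epsilon_B=\frac{1}{\nu t}\int_0^t L^{-3}\int|(-\Delta)^{-1/2}f(x,s)|^2dxds$, and $B=4E_0+t\epsilon_B$.
   Context: All spatial integrals are over one period cell $[0,L]^3$; $\|\cdot\|_{L^\infty}$ is the spatial sup-norm. $(-\Delta)^{-1/2}$ is defined on mean-zero $L$-periodic functions via Fourier series. *)

theory Defs
  imports "HOL-Analysis.Analysis"
begin

definition dderiv :: "'a::real_normed_vector set \<Rightarrow> ('a \<Rightarrow> 'b::real_normed_vector) \<Rightarrow> 'a \<Rightarrow> 'a \<Rightarrow> 'b" where
  "dderiv S F v p = frechet_derivative F (at p within S) v"

fun iter_dderiv :: "'a::real_normed_vector set \<Rightarrow> 'a list \<Rightarrow> ('a \<Rightarrow> 'b::real_normed_vector) \<Rightarrow> 'a \<Rightarrow> 'b" where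
  "iter_dderiv S [] F = F"
| "iter_dderiv S (v # vs) F = dderiv S (iter_dderiv S vs F) v"

definition smooth_on :: "'a::real_normed_vector set \<Rightarrow> ('a \<Rightarrow> 'b::real_normed_vector) \<Rightarrow> bool" where
  "smooth_on S F \<longleftrightarrow> (\<forall>vs. \<forall>p\<in>S. iter_dderiv S vs F differentiable (at p within S))"

definition ST :: "real \<Rightarrow> ((real^3) \<times> real) set" where
  "ST T = UNIV \<times> {0..T}"

definition px :: "real \<Rightarrow> 3 \<Rightarrow> (real^3 \<Rightarrow> real \<Rightarrow> 'b::real_normed_vector) \<Rightarrow> real^3 \<Rightarrow> real \<Rightarrow> 'b" where
  "px T j F x t = dderiv (ST T) (case_prod F) (axis j 1, 0) (x, t)"

definition pt :: "real \<Rightarrow> (real^3 \<Rightarrow> real \<Rightarrow> 'b::real_normed_vector) \<Rightarrow> real^3 \<Rightarrow> real \<Rightarrow> 'b" where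
  "pt T F x t = dderiv (ST T) (case_prod F) (0, 1) (x, t)"

definition grad_sq :: "real \<Rightarrow> (real^3 \<Rightarrow> real \<Rightarrow> real^3) \<Rightarrow> real^3 \<Rightarrow> real \<Rightarrow> real" where
  "grad_sq T F x t = (\<Sum>j\<in>UNIV. (norm (px T j F x t))\<^sup>2)"

definition lap :: "real \<Rightarrow> (real^3 \<Rightarrow> real \<Rightarrow> real^3) \<Rightarrow> real^3 \<Rightarrow> real \<Rightarrow> real^3" where
  "lap T F x t = (\<Sum>j\<in>UNIV. px T j (px T j F) x t)"

definition divg :: "real \<Rightarrow> (real^3 \<Rightarrow> real \<Rightarrow> real^3) \<Rightarrow> real^3 \<Rightarrow> real \<Rightarrow> real" where
  "divg T F x t = (\<Sum>j\<in>UNIV. (px T j F x t) $ j)"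

definition adv :: "real \<Rightarrow> (real^3 \<Rightarrow> real \<Rightarrow> real^3) \<Rightarrow> (real^3 \<Rightarrow> real \<Rightarrow> real^3) \<Rightarrow> real^3 \<Rightarrow> real \<Rightarrow> real^3" where
  "adv T u F x t = (\<Sum>j\<in>UNIV. (u x t $ j) *\<^sub>R px T j F x t)"

definition periodic_field :: "real \<Rightarrow> real \<Rightarrow> (real^3 \<Rightarrow> real \<Rightarrow> 'b) \<Rightarrow> bool" where
  "periodic_field L T F \<longleftrightarrow> (\<forall>x j. \<forall>t\<in>{0..T}. F (x + L *\<^sub>R axis j 1) t = F x t)"

definition cell :: "real \<Rightarrow> (real^3) set" where
  "cell L = cbox 0 (\<chi> i. L)"

definition sint :: "real \<Rightarrow> (real^3 \<Rightarrow> 'b::{banach,second_countable_topology}) \<Rightarrow> 'b" where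
  "sint L g = (LINT x:cell L|lborel. g x)"

definition Linf :: "(real^3 \<Rightarrow> 'b::real_normed_vector) \<Rightarrow> real" where
  "Linf g = (SUP x. norm (g x))"

definition kvec :: "int^3 \<Rightarrow> real^3" where
  "kvec k = (\<chi> i. of_int (k $ i))"

definition fcoef :: "real \<Rightarrow> (real^3 \<Rightarrow> real) \<Rightarrow> int^3 \<Rightarrow> complex" where
  "fcoef L g k = (1 / (complex_of_real L ^ 3)) *
     (LINT x:cell L|lborel. complex_of_real (g x) * cis (- 2 * pi * (kvec k \<bullet> x) / L))"

text \<open>For mean-zero L-periodic g: sum over k \<noteq> 0 of |2 pi k / L|^(-1) ghat_k e^(2 pi i k.x/L),
  componentwise.\<close>
definition neg_lap_inv_sqrt :: "real \<Rightarrow> (real^3 \<Rightarrow> real^3) \<Rightarrow> real^3 \<Rightarrow> real^3" where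
  "neg_lap_inv_sqrt L g x = (\<chi> i. Re (infsum (\<lambda>k.
      complex_of_real (L / (2 * pi * norm (kvec k))) * fcoef L (\<lambda>y. g y $ i) k
        * cis (2 * pi * (kvec k \<bullet> x) / L)) {k. k \<noteq> 0}))"

end

theory Submission
  imports Defs
begin

text \<open>
  \<^bold>\<open>Sup bound.\<close> For a unit vector \<open>e\<close>, the scalar \<open>e \<bullet> l\<close> solves a drift-diffusion equation with
  source \<open>- e \<bullet> u\<close>, so the maximum principle bounds it by \<open>\<integral> \<parallel>u\<parallel>\<^sub>\<infinity>\<close>.

  \<^bold>\<open>Energy.\<close> Put \<open>b = L\<^sup>3 B\<close>. The hypothesis with \<open>k\<^sub>1\<close> gives \<open>\<integral>|u(s)|\<^sup>2 \<le> b\<close> for all \<open>s \<le> t\<close>. Testing the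
  equation with \<open>l\<close> and using Young with weight \<open>1/(s + \<delta>)\<close> gives
  \<open>Y' + 2\<nu> \<integral>|\<nabla>l|\<^sup>2 \<le> Y/(s + \<delta>) + b (s + \<delta>)\<close> for \<open>Y = \<integral>|l|\<^sup>2\<close>; hence \<open>(Y/(s + \<delta>))' \<le> b\<close>, and
  \<open>\<delta> \<rightarrow> 0\<close> yields \<open>Y + 2\<nu> \<integral>\<integral>|\<nabla>l|\<^sup>2 \<le> b t\<^sup>2\<close>.

  \<^bold>\<open>Gradient.\<close> Testing with \<open>-\<Delta>l\<close>, the transport term equals
  \<open>\<Sum>\<^sub>j\<^sub>k \<integral> \<partial>\<^sub>k u\<^sub>j (\<partial>\<^sub>j \<partial>\<^sub>k l \<bullet> l)\<close>, which is at most
  \<open>(\<nu>/4) \<integral>|\<Delta>l|\<^sup>2 + (K\<^sub>\<infinity>\<^sup>2/\<nu>) \<integral>|\<nabla>u|\<^sup>2\<close> because \<open>\<integral>|\<nabla>\<nabla>l|\<^sup>2 = \<integral>|\<Delta>l|\<^sup>2\<close>; the energy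
  hypothesis controls \<open>\<nu> \<integral>\<integral>|\<nabla>u|\<^sup>2\<close>. This gives the constant \<open>C = 2\<close>.

  Using \<open>k\<^sub>1(s) \<le> k\<^sub>1(t)\<close> requires the Bochner integral of \<open>\<integral>|(-\<Delta>)\<^sup>-\<^sup>1\<^sup>/\<^sup>2 f|\<^sup>2\<close> to be a genuine one
  (it is \<open>0\<close> for a non-integrable integrand); the decay of the Fourier coefficients of \<open>f\<close>,
  uniform in time, makes the integrand continuous.
\<close>

section \<open>Calculus on the period cell\<close>

definition periodic :: "real \<Rightarrow> (real^3 \<Rightarrow> 'b) \<Rightarrow> bool" where
  "periodic L g \<longleftrightarrow> (\<forall>x j. g (x + L *\<^sub>R axis j 1) = g x)"

lemma periodicD: "periodic L g \<Longrightarrow> g (x + L *\<^sub>R axis j 1) = g x"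
  by (simp add: periodic_def)

lemma periodic_int:
  assumes "periodic L g"
  shows "g (x + (of_int n * L) *\<^sub>R axis j 1) = g x"
proof -
  have nat: "g (x + (of_nat n * L) *\<^sub>R axis j 1) = g x" for n :: nat and x
  proof (induction n)
    case (Suc n)
    have "x + (of_nat (Suc n) * L) *\<^sub>R axis j 1 = (x + (of_nat n * L) *\<^sub>R axis j 1) + L *\<^sub>R axis j 1"
      by (simp add: algebra_simps)
    then show ?case using Suc periodicD[OF assms] by metis
  qed simp
  show ?thesis
  proof (cases n)
    case (nonneg m)
    then show ?thesis using nat[of x m] by simp
  next
    case (neg m)
    \<comment> \<open>For negative \<open>n\<close> the natural-number case is applied at the
      shifted point, and \<open>Suc m\<close> periods lead back to \<open>x\<close>.\<close>
    have "g ((x + (of_int n * L) *\<^sub>R axis j 1) + (of_nat (Suc m) * L) *\<^sub>R axis j 1)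
        = g (x + (of_int n * L) *\<^sub>R axis j 1)"
      by (rule nat)
    moreover have "(x + (of_int n * L) *\<^sub>R axis j 1) + (of_nat (Suc m) * L) *\<^sub>R axis j 1 = x"
      by (simp add: neg algebra_simps)
    ultimately show ?thesis by metis
  qed
qed

text \<open>The representative of \<open>x\<close> modulo the period lattice, with coordinates in
  \<open>[0, L)\<close> when \<open>L > 0\<close>. It reduces suprema and maxima over all of space
  to the compact \<open>cell L\<close>.\<close>

definition wrap :: "real \<Rightarrow> real^3 \<Rightarrow> real^3" where
  "wrap L x = (\<chi> i. x $ i - of_int \<lfloor>x $ i / L\<rfloor> * L)"

lemma wrap_in_cell:
  assumes "L > 0"
  shows "wrap L x \<in> cell L"
proof -
  have "0 \<le> x $ i - of_int \<lfloor>x $ i / L\<rfloor> * L" "x $ i - of_int \<lfloor>x $ i / L\<rfloor> * L \<le> L" for i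
    using floor_divide_lower[OF assms, of "x $ i"] floor_divide_upper[OF assms, of "x $ i"]
    by (simp_all add: algebra_simps)
  then show ?thesis by (auto simp: cell_def wrap_def mem_box_cart)
qed

lemma periodic_wrap:
  assumes "periodic L g"
  shows "g (wrap L x) = g x"
proof -
  define n where "n i = - \<lfloor>x $ i / L\<rfloor>" for i
  have "wrap L x = x + (of_int (n 1) * L) *\<^sub>R axis 1 1 + (of_int (n 2) * L) *\<^sub>R axis 2 1
      + (of_int (n 3) * L) *\<^sub>R axis 3 1"
    by (simp add: vec_eq_iff forall_3 wrap_def axis_def n_def)
  then show ?thesis by (simp only: periodic_int[OF assms])
qed

text \<open>The cell and its translate by \<open>h\<close> along axis \<open>j\<close> share a slab;
  the two leftover slabs, both of thickness \<open>h\<close>, differ by exactly one period. Both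
  integrals therefore equal the same sum \<open>?I\<close>.\<close>

lemma integral_cell_shift:
  fixes g :: "real^3 \<Rightarrow> 'b::banach"
  assumes per: "periodic L g" and cont: "continuous_on UNIV g" and h: "0 \<le> h" "h \<le> L"
  shows "integral (cell L) (\<lambda>x. g (x + h *\<^sub>R axis j 1)) = integral (cell L) g"
proof -
  define e where "e = (axis j 1 :: real^3)"
  define Lv where "Lv = (\<chi> i. L :: real^3)"
  \<comment> \<open>Upper corner of the leftover slab, in which coordinate \<open>j\<close> runs
    over \<open>[0, h]\<close>.\<close>
  define w where "w = (\<chi> i. if i = j then h else L :: real^3)"
  have e: "e \<in> Basis" by (auto simp: e_def Basis_vec_def)
  have xe: "x \<bullet> e = x $ j" for x by (simp add: e_def inner_axis)
  have int: "g integrable_on cbox a b" for a b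
    by (rule integrable_continuous) (use cont continuous_on_subset in blast)
  have P1: "(g has_integral integral (cbox (h *\<^sub>R e) Lv) g) (cbox (h *\<^sub>R e) Lv)"
    and P2: "(g has_integral integral (cbox 0 w) g) (cbox 0 w)"
    using int by (simp_all add: integrable_integral)
  let ?I = "integral (cbox 0 w) g + integral (cbox (h *\<^sub>R e) Lv) g"
  have "(g has_integral ?I) (cbox 0 Lv)"
  proof (rule has_integral_split[OF _ _ e, where c = h])
    have "cbox 0 Lv \<inter> {x. x \<bullet> e \<le> h} = cbox 0 w"
    proof (rule set_eqI)
      fix x
      have "(x \<in> cbox 0 Lv \<inter> {x. x \<bullet> e \<le> h}) \<longleftrightarrow> (\<forall>i. 0 \<le> x $ i \<and> x $ i \<le> L \<and> (i = j \<longrightarrow> x $ i \<le> h))"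
        by (auto simp: xe mem_box_cart Lv_def)
      also have "\<dots> \<longleftrightarrow> x \<in> cbox 0 w"
        unfolding mem_box_cart by (rule iff_allI) (use h in \<open>auto simp: w_def\<close>)
      finally show "(x \<in> cbox 0 Lv \<inter> {x. x \<bullet> e \<le> h}) \<longleftrightarrow> x \<in> cbox 0 w" .
    qed
    then show "(g has_integral integral (cbox 0 w) g) (cbox 0 Lv \<inter> {x. x \<bullet> e \<le> h})"
      using P2 by simp
    have "cbox 0 Lv \<inter> {x. x \<bullet> e \<ge> h} = cbox (h *\<^sub>R e) Lv"
    proof (rule set_eqI)
      fix x
      have "(x \<in> cbox 0 Lv \<inter> {x. x \<bullet> e \<ge> h}) \<longleftrightarrow> (\<forall>i. 0 \<le> x $ i \<and> x $ i \<le> L \<and> (i = j \<longrightarrow> h \<le> x $ i))"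
        by (auto simp: xe mem_box_cart Lv_def)
      also have "\<dots> \<longleftrightarrow> x \<in> cbox (h *\<^sub>R e) Lv"
        unfolding mem_box_cart by (rule iff_allI) (use h in \<open>auto simp: Lv_def e_def axis_def\<close>)
      finally show "(x \<in> cbox 0 Lv \<inter> {x. x \<bullet> e \<ge> h}) \<longleftrightarrow> x \<in> cbox (h *\<^sub>R e) Lv" .
    qed
    then show "(g has_integral integral (cbox (h *\<^sub>R e) Lv) g) (cbox 0 Lv \<inter> {x. x \<bullet> e \<ge> h})"
      using P1 by simp
  qed
  then have 1: "integral (cell L) g = ?I"
    by (simp add: cell_def Lv_def integral_unique)
  \<comment> \<open>Periodicity carries this slab to the opposite face of the cell.\<close>
  have P2': "(g has_integral integral (cbox 0 w) g) (cbox (L *\<^sub>R e) (w + L *\<^sub>R e))"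
    using has_integral_affinity'[OF P2, of 1 "- L *\<^sub>R e"] periodicD[OF per, of "x - L *\<^sub>R e" j for x]
    by (simp add: e_def)
  have "(g has_integral (integral (cbox (h *\<^sub>R e) Lv) g + integral (cbox 0 w) g))
      (cbox (h *\<^sub>R e) (Lv + h *\<^sub>R e))"
  proof (rule has_integral_split[OF _ _ e, where c = L])
    have "cbox (h *\<^sub>R e) (Lv + h *\<^sub>R e) \<inter> {x. x \<bullet> e \<le> L} = cbox (h *\<^sub>R e) Lv"
    proof (rule set_eqI)
      fix x
      have "(x \<in> cbox (h *\<^sub>R e) (Lv + h *\<^sub>R e) \<inter> {x. x \<bullet> e \<le> L})
        \<longleftrightarrow> (\<forall>i. (h *\<^sub>R e) $ i \<le> x $ i \<and> x $ i \<le> (Lv + h *\<^sub>R e) $ i \<and> (i = j \<longrightarrow> x $ i \<le> L))"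
        by (auto simp: xe mem_box_cart)
      also have "\<dots> \<longleftrightarrow> x \<in> cbox (h *\<^sub>R e) Lv"
        unfolding mem_box_cart by (rule iff_allI) (use h in \<open>auto simp: Lv_def e_def axis_def\<close>)
      finally show "(x \<in> cbox (h *\<^sub>R e) (Lv + h *\<^sub>R e) \<inter> {x. x \<bullet> e \<le> L}) \<longleftrightarrow> x \<in> cbox (h *\<^sub>R e) Lv" .
    qed
    then show "(g has_integral integral (cbox (h *\<^sub>R e) Lv) g) (cbox (h *\<^sub>R e) (Lv + h *\<^sub>R e) \<inter> {x. x \<bullet> e \<le> L})"
      using P1 by simp
    have "cbox (h *\<^sub>R e) (Lv + h *\<^sub>R e) \<inter> {x. x \<bullet> e \<ge> L} = cbox (L *\<^sub>R e) (w + L *\<^sub>R e)"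
    proof (rule set_eqI)
      fix x
      have "(x \<in> cbox (h *\<^sub>R e) (Lv + h *\<^sub>R e) \<inter> {x. x \<bullet> e \<ge> L})
        \<longleftrightarrow> (\<forall>i. (h *\<^sub>R e) $ i \<le> x $ i \<and> x $ i \<le> (Lv + h *\<^sub>R e) $ i \<and> (i = j \<longrightarrow> L \<le> x $ i))"
        by (auto simp: xe mem_box_cart)
      also have "\<dots> \<longleftrightarrow> x \<in> cbox (L *\<^sub>R e) (w + L *\<^sub>R e)"
        unfolding mem_box_cart by (rule iff_allI) (use h in \<open>auto simp: w_def Lv_def e_def axis_def\<close>)
      finally show "(x \<in> cbox (h *\<^sub>R e) (Lv + h *\<^sub>R e) \<inter> {x. x \<bullet> e \<ge> L}) \<longleftrightarrow> x \<in> cbox (L *\<^sub>R e) (w + L *\<^sub>R e)" .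
    qed
    then show "(g has_integral integral (cbox 0 w) g) (cbox (h *\<^sub>R e) (Lv + h *\<^sub>R e) \<inter> {x. x \<bullet> e \<ge> L})"
      using P2' by simp
  qed
  from has_integral_affinity'[OF this, of 1 "h *\<^sub>R e"]
  have "((\<lambda>x. g (x + h *\<^sub>R e)) has_integral ?I) (cbox 0 Lv)"
    by (simp add: add.commute)
  then show ?thesis
    unfolding 1 by (simp add: e_def cell_def Lv_def integral_unique)
qed

text \<open>By \<open>integral_cell_shift\<close> the integral of the translate of \<open>g\<close>
  by \<open>h\<close> is constant for \<open>h\<close> in \<open>[0, L]\<close>, while
  differentiating under the integral at \<open>h = 0\<close> produces the integral of
  \<open>g'\<close>. Together with product rules this is the source of every integration by parts
  below.\<close>

lemma integral_partial_zero:
  fixes g :: "real^3 \<Rightarrow> 'b::banach"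
  assumes L: "L > 0" and per: "periodic L g" and cont: "continuous_on UNIV g"
    and der: "\<And>x. ((\<lambda>h. g (x + h *\<^sub>R axis j 1)) has_vector_derivative g' x) (at 0)"
    and cont': "continuous_on UNIV g'"
  shows "integral (cell L) g' = 0"
proof -
  let ?H = "\<lambda>h. integral (cell L) (\<lambda>x. g (x + h *\<^sub>R axis j 1))"
  have "((\<lambda>h. integral (cbox 0 (\<chi> i. L)) (\<lambda>x. g (x + h *\<^sub>R axis j 1))) has_vector_derivative
      integral (cbox 0 (\<chi> i. L)) (\<lambda>x. g' (x + 0 *\<^sub>R axis j 1))) (at 0 within {0..L})"
  proof (rule leibniz_rule_vector_derivative)
    fix h :: real and x :: "real^3"
    \<comment> \<open>\<open>der\<close> speaks only of the derivative at \<open>0\<close> for each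
      base point. The derivative at \<open>h\<close> comes from moving the base point, with the
      parameter written as \<open>s - h\<close>.\<close>
    have "((\<lambda>s. g ((x + h *\<^sub>R axis j 1) + s *\<^sub>R axis j 1)) has_vector_derivative g' (x + h *\<^sub>R axis j 1))
        (at (0 + 0) within (+) 0 ` UNIV)"
      using der[of "x + h *\<^sub>R axis j 1"] by simp
    then have "((\<lambda>s. g ((x + h *\<^sub>R axis j 1) + s *\<^sub>R axis j 1)) has_vector_derivative g' (x + h *\<^sub>R axis j 1))
        (at (h - h))"
      by simp
    moreover have "((\<lambda>s. s - h) has_vector_derivative 1) (at h)"
      by (auto intro!: derivative_eq_intros)
    ultimately have "((\<lambda>s. g (x + s *\<^sub>R axis j 1)) has_vector_derivative g' (x + h *\<^sub>R axis j 1)) (at h)"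
      using vector_diff_chain_at[of "\<lambda>s. s - h" 1 h] by (fastforce simp: o_def algebra_simps)
    then show "((\<lambda>s. g (x + s *\<^sub>R axis j 1)) has_vector_derivative g' (x + h *\<^sub>R axis j 1)) (at h within {0..L})"
      by (rule has_vector_derivative_at_within)
  next
    fix h :: real
    show "(\<lambda>x. g (x + h *\<^sub>R axis j 1)) integrable_on cbox 0 (\<chi> i. L)"
      by (intro integrable_continuous continuous_on_compose2[OF cont] continuous_intros) auto
  next
    show "continuous_on ({0..L} \<times> cbox 0 (\<chi> i. L)) (\<lambda>(h, x). g' (x + h *\<^sub>R axis j 1))"
      unfolding split_beta
      by (intro continuous_on_compose2[OF cont'] continuous_intros) auto
  qed (use L in auto)
  then have 1: "(?H has_vector_derivative integral (cell L) g') (at 0 within {0..L})"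
    by (simp add: cell_def)
  have "((\<lambda>h. integral (cell L) g) has_vector_derivative integral (cell L) g') (at 0 within {0..L})"
    by (rule has_vector_derivative_transform[OF _ _ 1])
      (use L integral_cell_shift[OF per cont] in auto)
  moreover have "((\<lambda>h. integral (cell L) g) has_vector_derivative 0) (at 0 within {0..L})"
    by (rule has_vector_derivative_const)
  moreover have "at 0 within {0..L} \<noteq> bot"
    using L by (simp add: trivial_limit_within islimpt_Icc)
  ultimately show ?thesis
    using vector_derivative_unique_within by blast
qed

text \<open>Derivatives are taken within a closed rectangle so that one variable can be time on
  \<open>{0..T}\<close>, with one-sided derivatives at the ends. Differentiating the fundamental
  theorem of calculus in \<open>b\<close> shows that the increment of \<open>FB\<close> in the first
  variable is the integral of \<open>FAB\<close>; differentiating this in \<open>a\<close> gives the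
  claim.\<close>

lemma mixed_partials_commute:
  fixes F :: "real \<Rightarrow> real \<Rightarrow> 'b::euclidean_space"
  assumes ab: "aL < aR" "bL < bR"
    and dA: "\<And>a b. a \<in> {aL..aR} \<Longrightarrow> b \<in> {bL..bR} \<Longrightarrow> ((\<lambda>s. F s b) has_vector_derivative FA a b) (at a within {aL..aR})"
    and dB: "\<And>a b. a \<in> {aL..aR} \<Longrightarrow> b \<in> {bL..bR} \<Longrightarrow> ((\<lambda>s. F a s) has_vector_derivative FB a b) (at b within {bL..bR})"
    and dAB: "\<And>a b. a \<in> {aL..aR} \<Longrightarrow> b \<in> {bL..bR} \<Longrightarrow> ((\<lambda>s. FA a s) has_vector_derivative FAB a b) (at b within {bL..bR})"
    and dBA: "\<And>a b. a \<in> {aL..aR} \<Longrightarrow> b \<in> {bL..bR} \<Longrightarrow> ((\<lambda>s. FB s b) has_vector_derivative FBA a b) (at a within {aL..aR})"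
    and cA: "\<And>b. b \<in> {bL..bR} \<Longrightarrow> continuous_on {aL..aR} (\<lambda>a. FA a b)"
    and cAB: "continuous_on ({bL..bR} \<times> {aL..aR}) (\<lambda>(b, a). FAB a b)"
    and x: "a \<in> {aL..aR}" "b \<in> {bL..bR}"
  shows "FAB a b = FBA a b"
proof -
  have FTC: "integral {aL..a} (\<lambda>s. FA s b) = F a b - F aL b" if "a \<in> {aL..aR}" "b \<in> {bL..bR}" for a b
    using that by (intro integral_unique fundamental_theorem_of_calculus has_vector_derivative_within_subset[OF dA]) auto
  have *: "FB a b - FB aL b = integral {aL..a} (\<lambda>s. FAB s b)" if a: "a \<in> {aL..aR}" and b: "b \<in> {bL..bR}" for a b
  proof -
    have "((\<lambda>b. integral (cbox aL a) (\<lambda>s. FA s b)) has_vector_derivative integral (cbox aL a) (\<lambda>s. FAB s b))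
        (at b within {bL..bR})"
    proof (rule leibniz_rule_vector_derivative)
      show "continuous_on ({bL..bR} \<times> cbox aL a) (\<lambda>(b, a). FAB a b)"
        by (rule continuous_on_subset[OF cAB]) (use a in auto)
      show "(\<lambda>s. FA s b) integrable_on cbox aL a" if "b \<in> {bL..bR}" for b
        by (rule integrable_continuous, rule continuous_on_subset[OF cA[OF that]]) (use a in auto)
    qed (use a b dAB in auto)
    then have 1: "((\<lambda>b. integral {aL..a} (\<lambda>s. FA s b)) has_vector_derivative integral {aL..a} (\<lambda>s. FAB s b))
        (at b within {bL..bR})" by simp
    have "((\<lambda>b. F a b - F aL b) has_vector_derivative integral {aL..a} (\<lambda>s. FAB s b)) (at b within {bL..bR})"
      by (rule has_vector_derivative_transform[OF _ _ 1]) (use FTC a b in auto)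
    moreover have "((\<lambda>b. F a b - F aL b) has_vector_derivative FB a b - FB aL b) (at b within {bL..bR})"
      using a b ab by (intro has_vector_derivative_diff dB) auto
    moreover have "at b within {bL..bR} \<noteq> bot"
      using ab b by (simp add: trivial_limit_within islimpt_Icc)
    ultimately show ?thesis
      using vector_derivative_unique_within by blast
  qed
  have "continuous_on {aL..aR} (\<lambda>s. FAB s b)"
  proof -
    have "continuous_on {aL..aR} (\<lambda>s. (\<lambda>(b, a). FAB a b) (b, s))"
      by (rule continuous_on_compose2[OF cAB]) (use x in \<open>auto intro: continuous_on_Pair continuous_on_const continuous_on_id\<close>)
    then show ?thesis by simp
  qed
  from integral_has_vector_derivative[OF this x(1)]
  have 1: "((\<lambda>u. integral {aL..u} (\<lambda>s. FAB s b)) has_vector_derivative FAB a b) (at a within {aL..aR})" .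
  have "((\<lambda>u. FB u b - FB aL b) has_vector_derivative FAB a b) (at a within {aL..aR})"
    by (rule has_vector_derivative_transform[OF _ _ 1]) (use * x in auto)
  moreover have "((\<lambda>u. FB u b - FB aL b) has_vector_derivative FBA a b - 0) (at a within {aL..aR})"
    using x by (intro has_vector_derivative_diff dBA has_vector_derivative_const) auto
  moreover have "at a within {aL..aR} \<noteq> bot"
    using ab x by (simp add: trivial_limit_within islimpt_Icc)
  ultimately show ?thesis
    using vector_derivative_unique_within by fastforce
qed

section \<open>Smooth periodic space-time fields\<close>

lemma iter_dderiv_append: "iter_dderiv S vs (iter_dderiv S ws F) = iter_dderiv S (vs @ ws) F"
  by (induction vs) auto

lemma smooth_on_iter_dderiv: "smooth_on S F \<Longrightarrow> smooth_on S (iter_dderiv S vs F)"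
  by (simp add: smooth_on_def iter_dderiv_append)

definition smooth_field :: "real \<Rightarrow> real \<Rightarrow> (real^3 \<Rightarrow> real \<Rightarrow> 'b::real_normed_vector) \<Rightarrow> bool" where
  "smooth_field L T F \<longleftrightarrow> smooth_on (ST T) (case_prod F) \<and> periodic_field L T F"

lemma smooth_field_periodic:
  "smooth_field L T F \<Longrightarrow> 0 \<le> t \<Longrightarrow> t \<le> T \<Longrightarrow> F (x + L *\<^sub>R axis j 1) t = F x t"
  by (simp add: smooth_field_def periodic_field_def)

lemma smooth_on_has_derivative:
  assumes "smooth_on S F" "p \<in> S"
  shows "(F has_derivative (\<lambda>v. dderiv S F v p)) (at p within S)"
proof -
  have "F differentiable (at p within S)"
    using assms unfolding smooth_on_def by (metis iter_dderiv.simps(1))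
  then show ?thesis by (simp add: frechet_derivative_works dderiv_def)
qed

text \<open>The parameter set \<open>A\<close> stays free: a spatial line lies in
  \<open>ST T\<close> entirely, whereas in the time direction the parameter must stay in
  \<open>{0..T}\<close>.\<close>

lemma has_derivative_imp_vector_derivative_line:
  assumes D: "(F has_derivative D) (at p within S)" and S: "\<And>s. s \<in> A \<Longrightarrow> p + (s - s0) *\<^sub>R v \<in> S"
  shows "((\<lambda>s. F (p + (s - s0) *\<^sub>R v)) has_vector_derivative D v) (at s0 within A)"
proof -
  let ?c = "\<lambda>s. p + (s - s0) *\<^sub>R v"
  have c: "(?c has_vector_derivative v) (at s0 within A)"
    by (auto intro!: derivative_eq_intros simp: has_vector_derivative_def)
  have "(F has_derivative D) (at (?c s0) within ?c ` A)"
    by (rule has_derivative_subset[where s = S]) (use D S in auto)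
  from has_derivative_in_compose[OF c[unfolded has_vector_derivative_def] this]
  have "((\<lambda>s. F (?c s)) has_derivative (\<lambda>s. D (s *\<^sub>R v))) (at s0 within A)" .
  moreover have "D (s *\<^sub>R v) = s *\<^sub>R D v" for s
    using has_derivative_linear[OF D] by (simp add: linear_cmul)
  ultimately show ?thesis by (simp add: has_vector_derivative_def)
qed

lemma smooth_field_px_deriv:
  assumes "smooth_field L T F" "0 \<le> t" "t \<le> T"
  shows "((\<lambda>s. F (x + s *\<^sub>R axis j 1) t) has_vector_derivative px T j F (x + a *\<^sub>R axis j 1) t) (at a within A)"
proof -
  have "(case_prod F has_derivative (\<lambda>v. dderiv (ST T) (case_prod F) v (x + a *\<^sub>R axis j 1, t)))
      (at (x + a *\<^sub>R axis j 1, t) within ST T)"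
    using assms by (intro smooth_on_has_derivative) (auto simp: smooth_field_def ST_def)
  from has_derivative_imp_vector_derivative_line[OF this, of A a "(axis j 1, 0)"] assms
  show ?thesis by (simp add: ST_def px_def algebra_simps)
qed

lemma smooth_field_pt_deriv:
  assumes "smooth_field L T F" "0 \<le> t" "t \<le> T"
  shows "((\<lambda>s. F x s) has_vector_derivative pt T F x t) (at t within {0..T})"
proof -
  have "(case_prod F has_derivative (\<lambda>v. dderiv (ST T) (case_prod F) v (x, t))) (at (x, t) within ST T)"
    using assms by (intro smooth_on_has_derivative) (auto simp: smooth_field_def ST_def)
  from has_derivative_imp_vector_derivative_line[OF this, of "{0..T}" t "(0, 1)"] assms
  show ?thesis by (simp add: ST_def pt_def)
qed

text \<open>\<open>px\<close> adds one entry to the list in \<open>iter_dderiv\<close>, so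
  smoothness persists. Periodicity persists by uniqueness of the derivative of a spatial
  slice.\<close>

lemma smooth_field_px [intro]:
  assumes "smooth_field L T F"
  shows "smooth_field L T (px T j F)"
proof -
  have "case_prod (px T j F) = iter_dderiv (ST T) [(axis j 1, 0)] (case_prod F)"
    by (auto simp: px_def fun_eq_iff)
  then have "smooth_on (ST T) (case_prod (px T j F))"
    using assms smooth_on_iter_dderiv by (metis smooth_field_def)
  moreover have "px T j F (x + L *\<^sub>R axis k 1) t = px T j F x t" if t: "0 \<le> t" "t \<le> T" for x t k
  proof -
    have "((\<lambda>s. F (x + L *\<^sub>R axis k 1 + s *\<^sub>R axis j 1) t) has_vector_derivative px T j F (x + L *\<^sub>R axis k 1) t) (at 0)"
      using smooth_field_px_deriv[OF assms t, of "x + L *\<^sub>R axis k 1" j 0 UNIV] by simp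
    moreover have "F (x + L *\<^sub>R axis k 1 + s *\<^sub>R axis j 1) t = F (x + s *\<^sub>R axis j 1) t" for s
      using smooth_field_periodic[OF assms t, of "x + s *\<^sub>R axis j 1" k] by (simp add: ac_simps)
    moreover have "((\<lambda>s. F (x + s *\<^sub>R axis j 1) t) has_vector_derivative px T j F x t) (at 0)"
      using smooth_field_px_deriv[OF assms t, of x j 0 UNIV] by simp
    ultimately show ?thesis using vector_derivative_unique_at by simp
  qed
  ultimately show ?thesis by (auto simp: smooth_field_def periodic_field_def)
qed

lemma not_bot_at_within_Icc: "T > 0 \<Longrightarrow> t \<in> {0..T::real} \<Longrightarrow> at t within {0..T} \<noteq> bot"
  by (simp add: trivial_limit_within islimpt_Icc)

text \<open>\<open>T > 0\<close> makes \<open>at t within {0..T}\<close> a nontrivial filter, so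
  that the time derivative, one-sided at the ends, is unique.\<close>

lemma smooth_field_pt [intro]:
  assumes F: "smooth_field L T F" and T: "T > 0"
  shows "smooth_field L T (pt T F)"
proof -
  have "case_prod (pt T F) = iter_dderiv (ST T) [(0, 1)] (case_prod F)"
    by (auto simp: pt_def fun_eq_iff)
  then have "smooth_on (ST T) (case_prod (pt T F))"
    using assms smooth_on_iter_dderiv by (metis smooth_field_def)
  moreover have "pt T F (x + L *\<^sub>R axis k 1) t = pt T F x t" if t: "t \<in> {0..T}" for x t k
  proof (rule vector_derivative_unique_within[OF not_bot_at_within_Icc[OF T t]])
    show "(F x has_vector_derivative pt T F x t) (at t within {0..T})"
      using smooth_field_pt_deriv[OF F, of t x] t by simp
    show "(F x has_vector_derivative pt T F (x + L *\<^sub>R axis k 1) t) (at t within {0..T})"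
      by (rule has_vector_derivative_transform[OF t _ smooth_field_pt_deriv[OF F, of t "x + L *\<^sub>R axis k 1"]])
        (use t smooth_field_periodic[OF F] in auto)
  qed
  ultimately show ?thesis by (auto simp: smooth_field_def periodic_field_def)
qed

text \<open>Arbitrary continuous arguments \<open>a\<close> and \<open>b\<close> let one rule cover
  spatial slices, time slices and joint continuity.\<close>

lemma smooth_field_continuous:
  assumes F: "smooth_field L T F" and a: "continuous_on A a" and b: "continuous_on A b"
    and ran: "\<And>z. z \<in> A \<Longrightarrow> 0 \<le> b z \<and> b z \<le> T"
  shows "continuous_on A (\<lambda>z. F (a z) (b z))"
proof -
  have "continuous_on (ST T) (case_prod F)"
    using F smooth_on_has_derivative[of "ST T" "case_prod F"] has_derivative_continuous
    unfolding smooth_field_def by (metis continuous_on_eq_continuous_within)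
  then have "continuous_on A (\<lambda>z. case_prod F (a z, b z))"
    by (rule continuous_on_compose2) (use a b ran in \<open>auto simp: ST_def intro!: continuous_on_Pair\<close>)
  then show ?thesis by simp
qed

lemma smooth_field_px_commute:
  fixes F :: "real^3 \<Rightarrow> real \<Rightarrow> 'b::euclidean_space"
  assumes F: "smooth_field L T F" and t: "0 \<le> t" "t \<le> T"
  shows "px T j (px T k F) x t = px T k (px T j F) x t"
proof -
  let ?y = "\<lambda>a b. x + a *\<^sub>R axis j 1 + b *\<^sub>R axis k 1"
  have swap: "?y a b = x + b *\<^sub>R axis k 1 + a *\<^sub>R axis j 1" for a b
    by (simp add: ac_simps)
  have "px T k (px T j F) (?y 0 0) t = px T j (px T k F) (?y 0 0) t"
  \<comment> \<open>The square with sides \<open>[-1, 1]\<close> is merely a neighbourhood of the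
    parameters \<open>0, 0\<close> at which the point \<open>x\<close> sits.\<close>
  proof (rule mixed_partials_commute[where aL = "-1" and aR = 1 and bL = "-1" and bR = 1
        and F = "\<lambda>a b. F (?y a b) t" and FA = "\<lambda>a b. px T j F (?y a b) t" and FB = "\<lambda>a b. px T k F (?y a b) t"
        and FAB = "\<lambda>a b. px T k (px T j F) (?y a b) t" and FBA = "\<lambda>a b. px T j (px T k F) (?y a b) t"])
    show "((\<lambda>s. F (?y s b) t) has_vector_derivative px T j F (?y a b) t) (at a within A)"
      "((\<lambda>s. px T k F (?y s b) t) has_vector_derivative px T j (px T k F) (?y a b) t) (at a within A)" for a b A
      unfolding swap by (rule smooth_field_px_deriv[OF F t], rule smooth_field_px_deriv[OF smooth_field_px[OF F] t])
    show "((\<lambda>s. F (?y a s) t) has_vector_derivative px T k F (?y a b) t) (at b within A)"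
      "((\<lambda>s. px T j F (?y a s) t) has_vector_derivative px T k (px T j F) (?y a b) t) (at b within A)" for a b A
      by (rule smooth_field_px_deriv[OF F t], rule smooth_field_px_deriv[OF smooth_field_px[OF F] t])
    show "continuous_on {-1..1} (\<lambda>a. px T j F (?y a b) t)" for b
      using t by (intro smooth_field_continuous[OF smooth_field_px[OF F]] continuous_intros) auto
    show "continuous_on ({-1..1} \<times> {-1..1}) (\<lambda>(b, a). px T k (px T j F) (?y a b) t)"
      unfolding split_beta
      using t by (intro smooth_field_continuous[OF smooth_field_px[OF smooth_field_px[OF F]]] continuous_intros) auto
  qed auto
  then show ?thesis by simp
qed

lemma smooth_field_pt_px_commute:
  fixes F :: "real^3 \<Rightarrow> real \<Rightarrow> 'b::euclidean_space"
  assumes F: "smooth_field L T F" and T: "T > 0" and t: "0 \<le> t" "t \<le> T"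
  shows "pt T (px T j F) x t = px T j (pt T F) x t"
proof -
  let ?y = "\<lambda>a. x + a *\<^sub>R axis j 1"
  have "pt T (px T j F) (?y 0) t = px T j (pt T F) (?y 0) t"
  proof (rule mixed_partials_commute[where aL = "-1" and aR = 1 and bL = 0 and bR = T
        and F = "\<lambda>a b. F (?y a) b" and FA = "\<lambda>a b. px T j F (?y a) b" and FB = "\<lambda>a b. pt T F (?y a) b"
        and FAB = "\<lambda>a b. pt T (px T j F) (?y a) b" and FBA = "\<lambda>a b. px T j (pt T F) (?y a) b"])
    show "((\<lambda>s. F (?y s) b) has_vector_derivative px T j F (?y a) b) (at a within A)"
      "((\<lambda>s. pt T F (?y s) b) has_vector_derivative px T j (pt T F) (?y a) b) (at a within A)"
      "((\<lambda>s. F (?y a) s) has_vector_derivative pt T F (?y a) b) (at b within {0..T})"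
      "((\<lambda>s. px T j F (?y a) s) has_vector_derivative pt T (px T j F) (?y a) b) (at b within {0..T})"
      if "b \<in> {0..T}" for a b A
      using F T that by (auto intro!: smooth_field_px_deriv smooth_field_pt_deriv)
    show "continuous_on {-1..1} (\<lambda>a. px T j F (?y a) b)" if "b \<in> {0..T}" for b
      using that by (intro smooth_field_continuous[OF smooth_field_px[OF F]] continuous_intros) auto
    show "continuous_on ({0..T} \<times> {-1..1}) (\<lambda>(b, a). pt T (px T j F) (?y a) b)"
      unfolding split_beta
      using t T by (intro smooth_field_continuous[OF smooth_field_pt[OF smooth_field_px[OF F]]] continuous_intros) auto
  qed (use t T in auto)
  then show ?thesis by simp
qed

section \<open>Cell integrals and time integrals of continuous fields\<close>

lemma continuous_integrable_on_cell:
  fixes g :: "real^3 \<Rightarrow> 'b::banach"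
  shows "continuous_on UNIV g \<Longrightarrow> g integrable_on cell L"
  unfolding cell_def by (rule integrable_continuous) (use continuous_on_subset in blast)

text \<open>Bridge from the Bochner integral of the theorem to the gauge integral in which the
  estimates are carried out; continuity on the compact cell makes the two agree.\<close>

lemma sint_eq_integral:
  fixes g :: "real^3 \<Rightarrow> 'b::euclidean_space"
  assumes "continuous_on (cell L) g"
  shows "sint L g = integral (cell L) g"
proof -
  have "set_integrable lborel (cell L) g"
    unfolding set_integrable_def
    by (rule borel_integrable_compact) (use assms in \<open>auto simp: cell_def\<close>)
  from set_borel_integral_eq_integral(2)[OF this] show ?thesis
    by (simp add: sint_def)
qed

lemma time_integral_eq:
  fixes g :: "real \<Rightarrow> real"
  assumes "continuous_on {a..b} g"
  shows "(LINT s:{a..b}|lborel. g s) = integral {a..b} g"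
  by (rule set_borel_integral_eq_integral(2)) (rule borel_integrable_atLeastAtMost'[OF assms])

lemma continuous_on_cell_integral:
  fixes G :: "real^3 \<Rightarrow> real \<Rightarrow> 'b::banach"
  assumes "continuous_on ({0..T} \<times> cell L) (\<lambda>z. G (snd z) (fst z))"
  shows "continuous_on {0..T} (\<lambda>s. integral (cell L) (\<lambda>x. G x s))"
  unfolding cell_def
  by (rule integral_continuous_on_param) (use assms in \<open>simp add: split_beta cell_def\<close>)

lemma cell_integral_time_deriv:
  fixes G :: "real^3 \<Rightarrow> real \<Rightarrow> real"
  assumes der: "\<And>x s. 0 \<le> s \<Longrightarrow> s \<le> T \<Longrightarrow> ((\<lambda>s. G x s) has_vector_derivative G' x s) (at s within {0..T})"
    and c: "\<And>s. 0 \<le> s \<Longrightarrow> s \<le> T \<Longrightarrow> continuous_on UNIV (\<lambda>x. G x s)"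
    and c': "continuous_on ({0..T} \<times> cell L) (\<lambda>z. G' (snd z) (fst z))"
    and t: "0 \<le> t" "t \<le> T"
  shows "((\<lambda>s. integral (cell L) (\<lambda>x. G x s)) has_real_derivative integral (cell L) (\<lambda>x. G' x t)) (at t within {0..T})"
  unfolding cell_def has_real_derivative_iff_has_vector_derivative
proof (rule leibniz_rule_vector_derivative)
  show "(\<lambda>x. G x s) integrable_on cbox 0 (\<chi> i. L)" if "s \<in> {0..T}" for s
    using that continuous_integrable_on_cell[OF c, of s] by (auto simp: cell_def)
  show "continuous_on ({0..T} \<times> cbox 0 (\<chi> i. L)) (\<lambda>(s, x). G' x s)"
    using c' by (simp add: split_beta cell_def)
qed (use der t in auto)

section \<open>Maximum principle\<close>

lemma smooth_field_wrap:
  assumes "smooth_field L T F" "0 \<le> t" "t \<le> T"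
  shows "F (wrap L x) t = F x t"
  by (rule periodic_wrap[of L "\<lambda>x. F x t"]) (simp add: periodic_def smooth_field_periodic[OF assms])

lemma compact_cell: "compact (cell L)"
  by (simp add: cell_def)

lemma smooth_field_bounded:
  assumes F: "smooth_field L T F" and L: "L > 0"
  obtains M where "M \<ge> 0" "\<And>x t. 0 \<le> t \<Longrightarrow> t \<le> T \<Longrightarrow> norm (F x t) \<le> M"
proof -
  have "continuous_on (cell L \<times> {0..T}) (\<lambda>z. F (fst z) (snd z))"
    by (rule smooth_field_continuous[OF F]) (auto intro!: continuous_intros)
  then have "bounded ((\<lambda>z. F (fst z) (snd z)) ` (cell L \<times> {0..T}))"
    by (intro compact_imp_bounded compact_continuous_image compact_Times compact_cell compact_Icc)
  then obtain M where M: "\<And>x t. x \<in> cell L \<Longrightarrow> t \<in> {0..T} \<Longrightarrow> norm (F x t) \<le> M"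
    unfolding bounded_iff by fastforce
  have "norm (F x t) \<le> max M 0" if "0 \<le> t" "t \<le> T" for x t
    using M[of "wrap L x" t] wrap_in_cell[OF L] smooth_field_wrap[OF F that] that by force
  then show ?thesis using that[of "max M 0"] by simp
qed

text \<open>\<open>Linf\<close> is a supremum of reals and bounds its members once the range is
  bounded above, which \<open>smooth_field_bounded\<close> supplies.\<close>

lemma norm_le_Linf:
  assumes F: "smooth_field L T F" and L: "L > 0" and t: "0 \<le> t" "t \<le> T"
  shows "norm (F x t) \<le> Linf (\<lambda>x. F x t)"
proof -
  obtain M where "\<And>x. norm (F x t) \<le> M"
    using smooth_field_bounded[OF F L] t by metis
  then show ?thesis
    unfolding Linf_def by (intro cSUP_upper) (auto simp: bdd_above_def)
qed

lemma Linf_le: "(\<And>x. norm (g x) \<le> c) \<Longrightarrow> Linf g \<le> c"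
  unfolding Linf_def by (rule cSUP_least) auto

text \<open>Uniform continuity on the compact set \<open>cell L \<times> {0..T}\<close> makes slices
  at nearby times uniformly close, and the supremum inherits this. The margin \<open>e / 2\<close>
  is there because a supremum weakens \<open><\<close> to \<open>\<le>\<close>.\<close>

lemma continuous_on_Linf:
  assumes F: "smooth_field L T F" and L: "L > 0"
  shows "continuous_on {0..T} (\<lambda>s. Linf (\<lambda>x. F x s))"
  unfolding continuous_on_iff
proof (intro ballI allI impI)
  fix s e :: real assume s: "s \<in> {0..T}" and e: "e > 0"
  have "continuous_on (cell L \<times> {0..T}) (\<lambda>z. F (fst z) (snd z))"
    by (rule smooth_field_continuous[OF F]) (auto intro!: continuous_intros)
  then have "uniformly_continuous_on (cell L \<times> {0..T}) (\<lambda>z. F (fst z) (snd z))"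
    by (intro compact_uniformly_continuous compact_Times compact_cell compact_Icc)
  then obtain d where d: "d > 0"
    and *: "\<And>z z'. z \<in> cell L \<times> {0..T} \<Longrightarrow> z' \<in> cell L \<times> {0..T} \<Longrightarrow> dist z' z < d
        \<Longrightarrow> dist (F (fst z') (snd z')) (F (fst z) (snd z)) < e / 2"
    unfolding uniformly_continuous_on_def using e by (meson half_gt_zero)
  have near: "norm (F x a - F x b) < e / 2" if "a \<in> {0..T}" "b \<in> {0..T}" "dist a b < d" for x a b
    using *[of "(wrap L x, b)" "(wrap L x, a)"] that wrap_in_cell[OF L, of x] smooth_field_wrap[OF F, of a x] smooth_field_wrap[OF F, of b x]
    by (simp add: dist_norm norm_Pair)
  have le: "Linf (\<lambda>x. F x a) \<le> Linf (\<lambda>x. F x b) + e / 2" if "a \<in> {0..T}" "b \<in> {0..T}" "dist a b < d" for a b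
  proof (rule Linf_le)
    fix x
    have "norm (F x a) \<le> norm (F x b) + norm (F x a - F x b)"
      by (metis norm_triangle_sub)
    then show "norm (F x a) \<le> Linf (\<lambda>x. F x b) + e / 2"
      using near[OF that, of x] norm_le_Linf[OF F L, of b x] that by simp
  qed
  show "\<exists>d>0. \<forall>s'\<in>{0..T}. dist s' s < d \<longrightarrow> dist (Linf (\<lambda>x. F x s')) (Linf (\<lambda>x. F x s)) < e"
  proof (intro exI conjI ballI impI)
    fix s' assume s': "s' \<in> {0..T}" "dist s' s < d"
    show "dist (Linf (\<lambda>x. F x s')) (Linf (\<lambda>x. F x s)) < e"
      using le[OF s'(1) s s'(2)] le[OF s s'(1)] s'(2) e by (simp add: dist_commute dist_real_def)
  qed (rule d)
qed

text \<open>A positive second derivative would make \<open>\<phi>'\<close> positive just to the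
  right of its zero, and the mean value theorem would then yield a value above the maximum.\<close>

lemma second_derivative_at_max:
  fixes \<phi> :: "real \<Rightarrow> real"
  assumes d1: "\<And>h. (\<phi> has_real_derivative \<phi>' h) (at h)" and d2: "(\<phi>' has_real_derivative d) (at 0)"
    and max: "\<And>h. \<phi> h \<le> \<phi> 0"
  shows "\<phi>' 0 = 0" "d \<le> 0"
proof -
  show 0: "\<phi>' 0 = 0"
    by (rule DERIV_local_max[OF d1, of 1]) (use max in auto)
  show "d \<le> 0"
  proof (rule ccontr)
    assume "\<not> d \<le> 0"
    then obtain r where r: "r > 0" "\<And>h. 0 < h \<Longrightarrow> h < r \<Longrightarrow> 0 < \<phi>' h"
      using DERIV_pos_inc_right[OF d2] 0 by auto
    obtain z where "0 < z" "z < r / 2" "\<phi> (r / 2) - \<phi> 0 = (r / 2 - 0) * \<phi>' z"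
      using MVT2[of 0 "r / 2" \<phi> \<phi>'] d1 r(1) by auto
    moreover have "0 < \<phi>' z" using calculation r by auto
    ultimately show False using max[of "r / 2"] r(1) by (smt (verit) mult_pos_pos)
  qed
qed

text \<open>Collects the equation and the structure of the fields. The forcing and the energy
  inequality enter in \<open>drift_flow_bounds\<close>, through bounds on \<open>u\<close>.\<close>

locale drift_flow =
  fixes \<nu> L T :: real and u l :: "real^3 \<Rightarrow> real \<Rightarrow> real^3"
  assumes pos: "\<nu> > 0" "L > 0" "T > 0"
    and u: "smooth_field L T u" and l: "smooth_field L T l"
    and divfree: "\<And>x t. 0 \<le> t \<Longrightarrow> t \<le> T \<Longrightarrow> divg T u x t = 0"
    and eqn: "\<And>x t. 0 \<le> t \<Longrightarrow> t \<le> T \<Longrightarrow> pt T l x t + adv T u l x t - \<nu> *\<^sub>R lap T l x t + u x t = 0"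
    and init: "\<And>x. l x 0 = 0"
begin

abbreviation Uint where "Uint t \<equiv> integral {0..t} (\<lambda>s. Linf (\<lambda>x. u x s))"

lemma Uint_deriv:
  assumes "0 \<le> t" "t \<le> T"
  shows "(Uint has_real_derivative Linf (\<lambda>x. u x t)) (at t within {0..T})"
  using integral_has_vector_derivative[OF continuous_on_Linf[OF u pos(2)], of t] assms
  by (simp add: has_real_derivative_iff_has_vector_derivative)

lemma Linf_u_nonneg: "0 \<le> t \<Longrightarrow> t \<le> T \<Longrightarrow> 0 \<le> Linf (\<lambda>x. u x t)"
  using norm_le_Linf[OF u pos(2)] norm_ge_zero order_trans by blast

text \<open>At a positive-time maximum of \<open>e \<bullet> l - Uint - \<epsilon> t\<close> the gradient vanishes and the
  Laplacian is nonpositive, so the equation forces a negative time derivative.\<close>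

lemma inner_l_le_eps:
  assumes e: "norm e = 1" and eps: "\<epsilon> > 0" and s: "0 \<le> s" "s \<le> T"
  shows "e \<bullet> l x s \<le> Uint s + \<epsilon> * s"
proof -
  define w where "w x s = e \<bullet> l x s - Uint s - \<epsilon> * s" for x s
  have contUint: "continuous_on {0..T} Uint"
    by (rule DERIV_continuous_on[of _ _ "\<lambda>t. Linf (\<lambda>x. u x t)"]) (use Uint_deriv in auto)
  have "continuous_on (cell L \<times> {0..T}) (\<lambda>z. w (fst z) (snd z))"
    unfolding w_def
    by (intro continuous_intros smooth_field_continuous[OF l] continuous_on_compose2[OF contUint]) auto
  moreover have "cell L \<times> {0..T} \<noteq> {}"
    using wrap_in_cell[OF pos(2)] pos(3) by auto
  ultimately obtain z where z: "z \<in> cell L \<times> {0..T}"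
    and zmax: "\<And>y. y \<in> cell L \<times> {0..T} \<Longrightarrow> w (fst y) (snd y) \<le> w (fst z) (snd z)"
    using continuous_attains_sup[OF compact_Times[OF compact_cell compact_Icc]] by blast
  obtain x0 t0 where z_eq: "z = (x0, t0)" by force
  have t0: "0 \<le> t0" "t0 \<le> T" using z z_eq by auto
  \<comment> \<open>Periodicity extends the maximum over the compact cylinder to all of space, so
    derivatives in every direction can be tested at \<open>x0\<close> even on the boundary of the
    cell.\<close>
  have wmax: "w y r \<le> w x0 t0" if "0 \<le> r" "r \<le> T" for y r
    using zmax[of "(wrap L y, r)"] wrap_in_cell[OF pos(2)] smooth_field_wrap[OF l that] that
    by (auto simp: z_eq w_def)
  have "t0 = 0"
  proof (rule ccontr)
    assume "t0 \<noteq> 0"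
    have space: "e \<bullet> px T j l x0 t0 = 0 \<and> e \<bullet> px T j (px T j l) x0 t0 \<le> 0" for j
    proof -
      have d: "((\<lambda>h. e \<bullet> F (x0 + h *\<^sub>R axis j 1) t0) has_real_derivative e \<bullet> px T j F (x0 + h *\<^sub>R axis j 1) t0) (at h)"
        if "smooth_field L T F" for F :: "real^3 \<Rightarrow> real \<Rightarrow> real^3" and h
        unfolding has_real_derivative_iff_has_vector_derivative
        by (rule bounded_linear.has_vector_derivative[OF bounded_linear_inner_right smooth_field_px_deriv[OF that t0]])
      have "e \<bullet> l (x0 + h *\<^sub>R axis j 1) t0 \<le> e \<bullet> l (x0 + 0 *\<^sub>R axis j 1) t0" for h
        using wmax[OF t0, of "x0 + h *\<^sub>R axis j 1"] by (simp add: w_def)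
      from second_derivative_at_max[OF d[OF l] d[OF smooth_field_px[OF l], where h = 0] this]
      show ?thesis by simp
    qed
    have dt: "(w x0 has_real_derivative e \<bullet> pt T l x0 t0 - Linf (\<lambda>x. u x t0) - \<epsilon>) (at t0 within {0..T})"
      unfolding w_def
      using bounded_linear.has_vector_derivative[OF bounded_linear_inner_right smooth_field_pt_deriv[OF l t0]]
      by (auto intro!: derivative_eq_intros Uint_deriv t0 simp: has_real_derivative_iff_has_vector_derivative[symmetric])
    have "\<not> e \<bullet> pt T l x0 t0 - Linf (\<lambda>x. u x t0) - \<epsilon> < 0"
    proof
      assume "e \<bullet> pt T l x0 t0 - Linf (\<lambda>x. u x t0) - \<epsilon> < 0"
      \<comment> \<open>The comparison is with earlier times only, so it also works at
        \<open>t0 = T\<close>.\<close>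
      from has_real_derivative_neg_dec_left[OF dt this] obtain d where d: "d > 0"
        "\<And>h. h > 0 \<Longrightarrow> t0 - h \<in> {0..T} \<Longrightarrow> h < d \<Longrightarrow> w x0 t0 < w x0 (t0 - h)" by blast
      define h where "h = min (d / 2) t0"
      have "h > 0" "h < d" "h \<le> t0" using d(1) \<open>t0 \<noteq> 0\<close> t0 by (auto simp: h_def)
      then show False using d(2)[of h] wmax[of "t0 - h" x0] t0 by simp
    qed
    moreover have "e \<bullet> pt T l x0 t0 \<le> Linf (\<lambda>x. u x t0)"
    proof -
      have "0 = e \<bullet> (pt T l x0 t0 + adv T u l x0 t0 - \<nu> *\<^sub>R lap T l x0 t0 + u x0 t0)"
        using eqn[OF t0] by simp
      \<comment> \<open>The transport term drops out because every first derivative of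
        \<open>e \<bullet> l\<close> vanishes at the maximum.\<close>
      also have "\<dots> = e \<bullet> pt T l x0 t0 - \<nu> * (\<Sum>j\<in>UNIV. e \<bullet> px T j (px T j l) x0 t0) + e \<bullet> u x0 t0"
        using space by (simp add: adv_def lap_def inner_add_right inner_diff_right inner_sum_right)
      finally have "e \<bullet> pt T l x0 t0 \<le> - (e \<bullet> u x0 t0)"
        using space pos(1) sum_nonpos[of UNIV "\<lambda>j. e \<bullet> px T j (px T j l) x0 t0"]
        by (smt (verit) mult_nonneg_nonpos)
      also have "\<dots> \<le> norm (u x0 t0)"
        using Cauchy_Schwarz_ineq2[of e "u x0 t0"] e by simp
      also have "\<dots> \<le> Linf (\<lambda>x. u x t0)" by (rule norm_le_Linf[OF u pos(2) t0])
      finally show ?thesis .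
    qed
    ultimately show False using eps by simp
  qed
  then have "w x s \<le> 0" using wmax[OF s, of x] by (simp add: w_def init)
  then show ?thesis by (simp add: w_def)
qed

text \<open>Choosing the unit vector along \<open>l x s\<close> turns the scalar bounds into a bound
  on the norm without any dimensional constant.\<close>

lemma norm_l_le:
  assumes s: "0 \<le> s" "s \<le> T"
  shows "norm (l x s) \<le> Uint s"
proof (rule field_le_epsilon)
  fix \<epsilon> :: real assume eps: "\<epsilon> > 0"
  have Uint0: "Uint s \<ge> 0"
    by (rule integral_nonneg) (use s Linf_u_nonneg continuous_on_Linf[OF u pos(2)] in \<open>auto intro!: integrable_continuous_real elim: continuous_on_subset\<close>)
  show "norm (l x s) \<le> Uint s + \<epsilon>"
  proof (cases "l x s = 0")
    case False
    have "norm (l x s) = sgn (l x s) \<bullet> l x s"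
      using False by (simp add: sgn_div_norm inner_commute dot_square_norm power2_eq_square)
    \<comment> \<open>The slope \<open>\<epsilon> / T\<close> costs at most
      \<open>\<epsilon>\<close> over the whole time interval.\<close>
    also have "\<dots> \<le> Uint s + (\<epsilon> / T) * s"
      by (rule inner_l_le_eps) (use False eps pos s in \<open>auto simp: norm_sgn\<close>)
    also have "\<dots> \<le> Uint s + \<epsilon>" using eps pos(3) s by (simp add: field_simps)
    finally show ?thesis .
  qed (use Uint0 eps in simp)
qed

end

section \<open>Energy estimate\<close>

text \<open>Periodic \<open>g\<close> with continuous partial derivative \<open>g'\<close> along
  axis \<open>j\<close>. The predicate is closed under products and, for \<open>L > 0\<close>,
  forces \<open>g'\<close> to have zero integral over the cell, so that an integration by parts
  amounts to building one instance.\<close>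

definition pdiff :: "real \<Rightarrow> 3 \<Rightarrow> (real^3 \<Rightarrow> 'b::banach) \<Rightarrow> (real^3 \<Rightarrow> 'b) \<Rightarrow> bool" where
  "pdiff L j g g' \<longleftrightarrow> periodic L g \<and> continuous_on UNIV g \<and> continuous_on UNIV g' \<and>
     (\<forall>x. ((\<lambda>h. g (x + h *\<^sub>R axis j 1)) has_vector_derivative g' x) (at 0))"

lemma pdiff_has_integral: "pdiff L j g g' \<Longrightarrow> L > 0 \<Longrightarrow> (g' has_integral 0) (cell L)"
  using integral_partial_zero[of L g j g'] continuous_integrable_on_cell[of g' L]
  by (auto simp: pdiff_def has_integral_integrable_integral)

lemma pdiff_field:
  fixes F :: "real^3 \<Rightarrow> real \<Rightarrow> 'b::banach"
  assumes F: "smooth_field L T F" and t: "0 \<le> t" "t \<le> T"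
  shows "pdiff L j (\<lambda>x. F x t) (\<lambda>x. px T j F x t)"
  unfolding pdiff_def
proof (intro conjI allI)
  show "((\<lambda>h. F (x + h *\<^sub>R axis j 1) t) has_vector_derivative px T j F x t) (at 0)" for x
    using smooth_field_px_deriv[OF F t, of x j 0] by simp
  show "continuous_on UNIV (\<lambda>x. F x t)" "continuous_on UNIV (\<lambda>x. px T j F x t)"
    using t by (auto intro!: smooth_field_continuous[OF F] smooth_field_continuous[OF smooth_field_px[OF F]] continuous_intros)
qed (simp add: periodic_def smooth_field_periodic[OF F t])

text \<open>One product rule for inner products, real products and complex products.\<close>

lemma pdiff_bilinear:
  fixes prod :: "'a::banach \<Rightarrow> 'b::banach \<Rightarrow> 'c::banach"
  assumes "bounded_bilinear prod" and g: "pdiff L j g g'" and h: "pdiff L j h h'"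
  shows "pdiff L j (\<lambda>x. prod (g x) (h x)) (\<lambda>x. prod (g x) (h' x) + prod (g' x) (h x))"
proof -
  interpret bounded_bilinear prod by fact
  have "((\<lambda>s. prod (g (x + s *\<^sub>R axis j 1)) (h (x + s *\<^sub>R axis j 1))) has_vector_derivative
      prod (g (x + 0 *\<^sub>R axis j 1)) (h' x) + prod (g' x) (h (x + 0 *\<^sub>R axis j 1))) (at 0)" for x
    using g h unfolding pdiff_def by (intro has_vector_derivative) auto
  moreover have "continuous_on UNIV (\<lambda>x. prod (g x) (h x))"
    "continuous_on UNIV (\<lambda>x. prod (g x) (h' x) + prod (g' x) (h x))"
    by (rule continuous_on continuous_on_add; use g h in \<open>simp add: pdiff_def continuous_on\<close>)+
  ultimately show ?thesis using g h by (simp add: pdiff_def periodic_def)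
qed

lemmas pdiff_inner = pdiff_bilinear[OF bounded_bilinear_inner]
  and pdiff_mult = pdiff_bilinear[OF bounded_bilinear_mult]

lemma pdiff_nth:
  fixes g :: "real^3 \<Rightarrow> real^3"
  shows "pdiff L j g g' \<Longrightarrow> pdiff L j (\<lambda>x. g x $ i) (\<lambda>x. g' x $ i)"
  by (simp add: pdiff_def periodic_def bounded_linear.continuous_on[OF bounded_linear_vec_nth]
      bounded_linear.has_vector_derivative[OF bounded_linear_vec_nth])

text \<open>\<open>px\<close> is defined through a space-time derivative, so agreement of
  \<open>F\<close> and \<open>G\<close> at a single time does not rewrite it directly; the
  derivative is recovered from the spatial slice.\<close>

lemma px_cong:
  assumes F: "smooth_field L T F" and G: "smooth_field L T G" and t: "0 \<le> t" "t \<le> T"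
    and eq: "\<And>x. F x t = G x t"
  shows "px T j F x t = px T j G x t"
proof (rule vector_derivative_unique_at)
  show "((\<lambda>s. F (x + s *\<^sub>R axis j 1) t) has_vector_derivative px T j F x t) (at 0)"
    using smooth_field_px_deriv[OF F t, of x j 0 UNIV] by simp
  show "((\<lambda>s. F (x + s *\<^sub>R axis j 1) t) has_vector_derivative px T j G x t) (at 0)"
    using smooth_field_px_deriv[OF G t, of x j 0 UNIV] by (simp add: eq)
qed

text \<open>The fundamental theorem of calculus accepts derivatives within the interval, so the
  endpoints need no separate treatment; the increment is the integral of a nonnegative
  function.\<close>

lemma nondecreasing_from_within_deriv:
  fixes f :: "real \<Rightarrow> real"
  assumes "0 \<le> t" "t \<le> T"
    and "\<And>s. 0 \<le> s \<Longrightarrow> s \<le> t \<Longrightarrow> (f has_real_derivative f' s) (at s within {0..T})"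
    and "\<And>s. 0 \<le> s \<Longrightarrow> s \<le> t \<Longrightarrow> f' s \<ge> 0"
  shows "f 0 \<le> f t"
proof -
  have "(f' has_integral (f t - f 0)) {0..t}"
  proof (rule fundamental_theorem_of_calculus)
    fix s assume "s \<in> {0..t}"
    then have "(f has_real_derivative f' s) (at s within {0..t})"
      by (intro DERIV_subset[OF assms(3)]) (use assms(2) in auto)
    then show "(f has_vector_derivative f' s) (at s within {0..t})"
      by (simp add: has_real_derivative_iff_has_vector_derivative)
  qed (rule assms)
  then have "0 \<le> f t - f 0"
    by (rule has_integral_nonneg) (use assms(4) in simp)
  then show ?thesis by simp
qed

lemma time_integral_deriv:
  fixes g :: "real \<Rightarrow> real"
  assumes "continuous_on {0..T} g" "0 \<le> s" "s \<le> T"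
  shows "((\<lambda>t. integral {0..t} g) has_real_derivative g s) (at s within {0..T})"
  using integral_has_vector_derivative[OF assms(1), of s] assms
  by (simp add: has_real_derivative_iff_has_vector_derivative)

lemma young:
  fixes a b c :: real
  assumes "c > 0"
  shows "2 * a * b \<le> c * a\<^sup>2 + b\<^sup>2 / c"
proof -
  have "0 \<le> (c * a - b)\<^sup>2 / c" using assms by simp
  also have "\<dots> = c * a\<^sup>2 + b\<^sup>2 / c - 2 * a * b"
    using assms by (simp add: field_simps power2_eq_square)
  finally show ?thesis by simp
qed

section \<open>Testing the equation with \<open>l\<close>\<close>

context drift_flow
begin

abbreviation CI where "CI g \<equiv> integral (cell L) g"

lemma grad_sq_inner: "grad_sq T F x t = (\<Sum>j\<in>UNIV. px T j F x t \<bullet> px T j F x t)"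
  by (simp add: grad_sq_def dot_square_norm)

lemma continuous_on_grad_sq_lap:
  assumes "smooth_field L T F" "continuous_on X a" "continuous_on X b" "\<And>z. z \<in> X \<Longrightarrow> 0 \<le> b z \<and> b z \<le> T"
  shows "continuous_on X (\<lambda>z. grad_sq T F (a z) (b z))" "continuous_on X (\<lambda>z. lap T F (a z) (b z))"
  unfolding grad_sq_def lap_def
  by (intro continuous_on_sum continuous_on_power continuous_on_norm
      smooth_field_continuous[OF smooth_field_px[OF assms(1)] assms(2-)]
      smooth_field_continuous[OF smooth_field_px[OF smooth_field_px[OF assms(1)]] assms(2-)]; assumption)+

lemma slice_ranges:
  "continuous_on X (\<lambda>z. snd z)" "continuous_on X (\<lambda>z. fst z)"
  "z \<in> {0..T} \<times> cell L \<Longrightarrow> 0 \<le> fst z \<and> fst z \<le> T"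
  by (auto intro: continuous_intros)

lemma slice_continuous:
  fixes F :: "real^3 \<Rightarrow> real \<Rightarrow> 'b::real_normed_vector"
  assumes "smooth_field L T F" "0 \<le> s" "s \<le> T"
  shows "continuous_on UNIV (\<lambda>x. F x s)"
  using assms by (intro smooth_field_continuous[OF assms(1)] continuous_intros) auto

text \<open>Diffusion integrates to minus the gradient term, and transport integrates to zero
  because \<open>u\<close> is divergence-free; what remains is the source.\<close>

lemma energy_rate:
  assumes t: "0 \<le> t" "t \<le> T"
  shows "CI (\<lambda>x. 2 * (l x t \<bullet> pt T l x t)) + 2 * \<nu> * CI (\<lambda>x. grad_sq T l x t) = - CI (\<lambda>x. 2 * (u x t \<bullet> l x t))"
proof -
  note cont = slice_continuous[OF u t] slice_continuous[OF l t] slice_continuous[OF smooth_field_px[OF l] t]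
    slice_continuous[OF smooth_field_pt[OF l pos(3)] t]
  \<comment> \<open>\<open>Z1 j\<close> is the derivative along axis \<open>j\<close> of
    \<open>l \<bullet> px T j l\<close>, and \<open>Z2 j\<close> that of the \<open>j\<close>-th
    component of \<open>u\<close> times \<open>l \<bullet> l\<close>.\<close>
  define Z1 where "Z1 j x = l x t \<bullet> px T j (px T j l) x t + px T j l x t \<bullet> px T j l x t" for j x
  define Z2 where "Z2 j x = u x t $ j * (l x t \<bullet> px T j l x t + px T j l x t \<bullet> l x t) + px T j u x t $ j * (l x t \<bullet> l x t)" for j x
  have "(Z1 j has_integral 0) (cell L)" "(Z2 j has_integral 0) (cell L)" for j
    unfolding Z1_def Z2_def
    by (rule pdiff_has_integral[OF pdiff_inner[OF pdiff_field[OF l t] pdiff_field[OF smooth_field_px[OF l] t]] pos(2)],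
        rule pdiff_has_integral[OF pdiff_mult[OF pdiff_nth[OF pdiff_field[OF u t]]
          pdiff_inner[OF pdiff_field[OF l t] pdiff_field[OF l t]]] pos(2)])
  then have "((\<lambda>x. 2 * \<nu> * (\<Sum>j\<in>UNIV. Z1 j x) - (\<Sum>j\<in>UNIV. Z2 j x)) has_integral (2 * \<nu> * (\<Sum>j\<in>(UNIV::3 set). 0) - (\<Sum>j\<in>(UNIV::3 set). 0))) (cell L)"
    by (intro has_integral_diff has_integral_mult_right has_integral_sum) auto
  moreover have "2 * \<nu> * (\<Sum>j\<in>UNIV. Z1 j x) - (\<Sum>j\<in>UNIV. Z2 j x)
      = 2 * (l x t \<bullet> pt T l x t) + 2 * \<nu> * grad_sq T l x t + 2 * (u x t \<bullet> l x t)" for x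
  proof -
    \<comment> \<open>The left-hand side of \<open>eqn\<close> is split off as a whole so that it
      can be rewritten to \<open>0\<close>.\<close>
    have "pt T l x t = (pt T l x t + adv T u l x t - \<nu> *\<^sub>R lap T l x t + u x t) + (\<nu> *\<^sub>R lap T l x t - adv T u l x t - u x t)"
      by simp
    then have "pt T l x t = \<nu> *\<^sub>R lap T l x t - adv T u l x t - u x t"
      unfolding eqn[OF t] by simp
    then have "l x t \<bullet> pt T l x t = \<nu> * (l x t \<bullet> lap T l x t) - l x t \<bullet> adv T u l x t - u x t \<bullet> l x t"
      by (simp add: inner_diff_right inner_commute)
    moreover have "(\<Sum>j\<in>UNIV. Z1 j x) = l x t \<bullet> lap T l x t + grad_sq T l x t"
      by (simp add: Z1_def sum.distrib lap_def inner_sum_right grad_sq_inner)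
    moreover have "(\<Sum>j\<in>UNIV. Z2 j x) = 2 * (l x t \<bullet> adv T u l x t) + divg T u x t * (l x t \<bullet> l x t)"
      by (simp add: Z2_def sum.distrib adv_def inner_sum_right divg_def sum_distrib_right sum_distrib_left inner_commute algebra_simps)
    ultimately show ?thesis using divfree[OF t] by (simp add: algebra_simps)
  qed
  ultimately have "CI (\<lambda>x. 2 * (l x t \<bullet> pt T l x t) + 2 * \<nu> * grad_sq T l x t + 2 * (u x t \<bullet> l x t)) = 0"
    by (simp add: integral_unique)
  moreover have "(\<lambda>x. 2 * (l x t \<bullet> pt T l x t)) integrable_on cell L" "(\<lambda>x. 2 * \<nu> * grad_sq T l x t) integrable_on cell L"
    "(\<lambda>x. 2 * (u x t \<bullet> l x t)) integrable_on cell L"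
    unfolding grad_sq_def
    by (intro continuous_integrable_on_cell continuous_intros cont)+
  ultimately show ?thesis
    by (simp add: integral_add integrable_add)
qed

text \<open>Two passes over one differential inequality: the first drops the gradient term and
  bounds \<open>?Y\<close>, the second inserts that bound and keeps the gradient term. The shift
  \<open>\<delta>\<close> avoids the singular weight \<open>1 / s\<close> at
  \<open>s = 0\<close>.\<close>

lemma energy_bound:
  assumes t: "0 \<le> t" "t \<le> T" and b: "\<And>s. 0 \<le> s \<Longrightarrow> s \<le> t \<Longrightarrow> CI (\<lambda>x. (norm (u x s))\<^sup>2) \<le> b"
  shows "CI (\<lambda>x. (norm (l x t))\<^sup>2) + 2 * \<nu> * integral {0..t} (\<lambda>s. CI (\<lambda>x. grad_sq T l x s)) \<le> b * t\<^sup>2"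
    (is "?Y t + 2 * \<nu> * ?G t \<le> _")
proof -
  define g where "g s = CI (\<lambda>x. grad_sq T l x s)" for s
  define Y' where "Y' s = CI (\<lambda>x. 2 * (l x s \<bullet> pt T l x s))" for s
  note cu = slice_continuous[OF u] and cl = slice_continuous[OF l] and cpx = slice_continuous[OF smooth_field_px[OF l]]
  have g_cont: "continuous_on {0..T} g"
    unfolding g_def
    by (rule continuous_on_cell_integral) (intro continuous_on_grad_sq_lap(1) l slice_ranges)
  have g_nonneg: "g s \<ge> 0" if "0 \<le> s" "s \<le> T" for s
    unfolding g_def grad_sq_def
    by (rule integral_nonneg)
      (auto intro!: continuous_integrable_on_cell continuous_on_sum continuous_on_power continuous_on_norm cpx that sum_nonneg)
  have Y_deriv: "(?Y has_real_derivative Y' s) (at s within {0..T})" if s: "0 \<le> s" "s \<le> T" for s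
    unfolding Y'_def
  proof (rule cell_integral_time_deriv[OF _ _ _ s])
    show "((\<lambda>s. (norm (l x s))\<^sup>2) has_vector_derivative 2 * (l x s \<bullet> pt T l x s)) (at s within {0..T})"
      if s: "0 \<le> s" "s \<le> T" for x s
      using bounded_bilinear.has_vector_derivative[OF bounded_bilinear_inner smooth_field_pt_deriv[OF l s] smooth_field_pt_deriv[OF l s], of x x]
      by (simp add: dot_square_norm inner_commute)
    show "continuous_on UNIV (\<lambda>x. (norm (l x s))\<^sup>2)" if "0 \<le> s" "s \<le> T" for s
      by (intro continuous_on_power continuous_on_norm cl that)
    show "continuous_on ({0..T} \<times> cell L) (\<lambda>z. 2 * (l (snd z) (fst z) \<bullet> pt T l (snd z) (fst z)))"
      by (intro continuous_intros smooth_field_continuous[OF l] smooth_field_continuous[OF smooth_field_pt[OF l pos(3)]] slice_ranges)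
  qed
  \<comment> \<open>The Young weight is left free; both passes take the reciprocal of time plus
    \<open>\<delta>\<close>.\<close>
  have rate: "Y' s + 2 * \<nu> * g s \<le> \<mu> * ?Y s + b / \<mu>" if s: "0 \<le> s" "s \<le> t" and lam: "\<mu> > 0" for s \<mu>
  proof -
    have s': "s \<le> T" using s t by simp
    have int: "(\<lambda>x. - (2 * (u x s \<bullet> l x s))) integrable_on cell L"
      "(\<lambda>x. \<mu> * (norm (l x s))\<^sup>2 + (norm (u x s))\<^sup>2 / \<mu>) integrable_on cell L"
      "(\<lambda>x. \<mu> * (norm (l x s))\<^sup>2) integrable_on cell L" "(\<lambda>x. (norm (u x s))\<^sup>2 / \<mu>) integrable_on cell L"
      using lam by (intro continuous_integrable_on_cell continuous_intros cu[OF s(1) s'] cl[OF s(1) s']; simp)+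
    have "Y' s + 2 * \<nu> * g s = CI (\<lambda>x. - (2 * (u x s \<bullet> l x s)))"
      using energy_rate[OF s(1) s'] by (simp add: Y'_def g_def)
    also have "\<dots> \<le> CI (\<lambda>x. \<mu> * (norm (l x s))\<^sup>2 + (norm (u x s))\<^sup>2 / \<mu>)"
    proof (rule integral_le)
      fix x
      have "- (2 * (u x s \<bullet> l x s)) \<le> 2 * norm (l x s) * norm (u x s)"
        using Cauchy_Schwarz_ineq2[of "u x s" "l x s"] unfolding mult.assoc mult.commute[of "norm (l x s)"] by linarith
      also have "\<dots> \<le> \<mu> * (norm (l x s))\<^sup>2 + (norm (u x s))\<^sup>2 / \<mu>"
        by (rule young[OF lam])
      finally show "- (2 * (u x s \<bullet> l x s)) \<le> \<mu> * (norm (l x s))\<^sup>2 + (norm (u x s))\<^sup>2 / \<mu>" .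
    qed (use int in auto)
    also have "\<dots> = CI (\<lambda>x. \<mu> * (norm (l x s))\<^sup>2) + CI (\<lambda>x. (norm (u x s))\<^sup>2 / \<mu>)"
      by (rule integral_add) (use int in auto)
    also have "\<dots> = \<mu> * ?Y s + CI (\<lambda>x. (norm (u x s))\<^sup>2) / \<mu>"
      by simp
    also have "\<dots> \<le> \<mu> * ?Y s + b / \<mu>" using b[OF s] lam by (simp add: divide_right_mono)
    finally show ?thesis .
  qed
  have Y0: "?Y 0 = 0" by (simp add: init)
  have Y_le: "?Y s \<le> b * s * (s + \<delta>)" if s: "0 \<le> s" "s \<le> t" and \<delta>: "\<delta> > 0" for s \<delta>
  proof -
    \<comment> \<open>First pass: the derivative of \<open>?Y s / (s + \<delta>)\<close> is at most
      \<open>b\<close>.\<close>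
    have "b * 0 - ?Y 0 / (0 + \<delta>) \<le> b * s - ?Y s / (s + \<delta>)"
    proof (rule nondecreasing_from_within_deriv[of s T "\<lambda>s. b * s - ?Y s / (s + \<delta>)"])
      fix r assume r: "0 \<le> r" "r \<le> s"
      then have r': "r \<le> t" "r \<le> T" using s t by auto
      have "((\<lambda>s. s + \<delta>) has_real_derivative 1) (at r within {0..T})" "((\<lambda>s. b * s) has_real_derivative b) (at r within {0..T})"
        by (auto intro!: derivative_eq_intros)
      moreover have "r + \<delta> \<noteq> 0" using r \<delta> by simp
      ultimately show "((\<lambda>s. b * s - ?Y s / (s + \<delta>)) has_real_derivative b - (Y' r * (r + \<delta>) - ?Y r * 1) / ((r + \<delta>) * (r + \<delta>))) (at r within {0..T})"
        by (intro DERIV_diff DERIV_divide Y_deriv r r')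
      have "Y' r \<le> ?Y r / (r + \<delta>) + b * (r + \<delta>)"
      proof -
        have "0 \<le> 2 * \<nu> * g r" using g_nonneg[OF r(1) r'(2)] pos(1) by simp
        moreover have "Y' r + 2 * \<nu> * g r \<le> ?Y r / (r + \<delta>) + b * (r + \<delta>)"
          using rate[OF r(1) r'(1), of "1 / (r + \<delta>)"] r(1) \<delta> by simp
        ultimately show ?thesis by linarith
      qed
      then have "Y' r * (r + \<delta>) \<le> (?Y r / (r + \<delta>) + b * (r + \<delta>)) * (r + \<delta>)"
        using r \<delta> by (intro mult_right_mono) auto
      also have "\<dots> = ?Y r + b * ((r + \<delta>) * (r + \<delta>))" using r \<delta> by (simp add: field_simps)
      finally show "0 \<le> b - (Y' r * (r + \<delta>) - ?Y r * 1) / ((r + \<delta>) * (r + \<delta>))"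
        using r \<delta> by (simp add: divide_le_eq)
    qed (use s t in auto)
    then show ?thesis using Y0 s \<delta> by (simp add: divide_le_eq mult.assoc)
  qed
  have b0: "b \<ge> 0"
  proof -
    have "0 \<le> CI (\<lambda>x. (norm (u x 0))\<^sup>2)"
      by (rule integral_nonneg) (use pos in \<open>auto intro!: continuous_integrable_on_cell continuous_on_power continuous_on_norm cu\<close>)
    then show ?thesis using b[of 0] t by simp
  qed
  have "?Y t + 2 * \<nu> * ?G t \<le> b * t\<^sup>2 + e" if e: "e > 0" for e
  proof -
    \<comment> \<open>The denominator stays positive when \<open>b * t = 0\<close>, and the choice
      makes the error \<open>b * \<delta> * t\<close> at most \<open>e\<close>.\<close>
    define \<delta> where "\<delta> = e / (b * t + 1)"
    have bt: "b * t \<ge> 0" using b0 t by simp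
    have \<delta>: "\<delta> > 0" using e bt by (simp add: \<delta>_def)
    \<comment> \<open>Second pass: since \<open>?Y s / (s + \<delta>) \<le> b * s\<close>, the
      right-hand side of \<open>rate\<close> is at most \<open>2 * b * s + b * \<delta>\<close>, the
      derivative of \<open>b * s\<^sup>2 + b * \<delta> * s\<close>.\<close>
    have "b * 0\<^sup>2 + b * \<delta> * 0 - ?Y 0 - 2 * \<nu> * integral {0..0} g \<le> b * t\<^sup>2 + b * \<delta> * t - ?Y t - 2 * \<nu> * integral {0..t} g"
    proof (rule nondecreasing_from_within_deriv[OF t, of "\<lambda>s. b * s\<^sup>2 + b * \<delta> * s - ?Y s - 2 * \<nu> * integral {0..s} g"])
      fix s assume s: "0 \<le> s" "s \<le> t"
      then have s': "s \<le> T" using t by simp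
      have "((\<lambda>s. b * s\<^sup>2 + b * \<delta> * s) has_real_derivative 2 * b * s + b * \<delta>) (at s within {0..T})"
        by (auto intro!: derivative_eq_intros)
      then show "((\<lambda>s. b * s\<^sup>2 + b * \<delta> * s - ?Y s - 2 * \<nu> * integral {0..s} g) has_real_derivative
          2 * b * s + b * \<delta> - Y' s - 2 * \<nu> * g s) (at s within {0..T})"
        by (intro DERIV_diff DERIV_cmult Y_deriv time_integral_deriv g_cont s(1) s')
      have "Y' s + 2 * \<nu> * g s \<le> ?Y s / (s + \<delta>) + b * (s + \<delta>)"
        using rate[OF s, of "1 / (s + \<delta>)"] s \<delta> by simp
      also have "?Y s / (s + \<delta>) \<le> b * s"
        using Y_le[OF s \<delta>] s \<delta> by (simp add: divide_le_eq mult.assoc)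
      finally show "0 \<le> 2 * b * s + b * \<delta> - Y' s - 2 * \<nu> * g s"
        by (simp add: algebra_simps)
    qed
    moreover have "b * \<delta> * t \<le> e"
    proof -
      have "b * \<delta> * t = e * (b * t / (b * t + 1))" by (simp add: \<delta>_def)
      also have "\<dots> \<le> e * 1" using e bt by (intro mult_left_mono) (auto simp: divide_le_eq)
      finally show ?thesis by simp
    qed
    ultimately show ?thesis using Y0 unfolding g_def[symmetric] by simp
  qed
  then show ?thesis by (rule field_le_epsilon)
qed

end

section \<open>Gradient estimate\<close>

context drift_flow
begin

text \<open>Differentiating the divergence condition along axis \<open>k\<close> and commuting
  derivatives shows that \<open>px T k u\<close> is again divergence-free.\<close>

lemma sum_px_px_u_zero:
  assumes t: "0 \<le> t" "t \<le> T"
  shows "(\<Sum>j\<in>UNIV. px T j (px T k u) x t $ j) = 0"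
proof -
  have "((\<lambda>s. \<Sum>j\<in>UNIV. px T j u (x + s *\<^sub>R axis k 1) t $ j) has_vector_derivative
      (\<Sum>j\<in>UNIV. px T k (px T j u) (x + 0 *\<^sub>R axis k 1) t $ j)) (at 0)"
    by (intro has_vector_derivative_sum bounded_linear.has_vector_derivative[OF bounded_linear_vec_nth]
        smooth_field_px_deriv[OF smooth_field_px[OF u] t])
  moreover have "(\<lambda>s. \<Sum>j\<in>UNIV. px T j u (x + s *\<^sub>R axis k 1) t $ j) = (\<lambda>s. 0)"
    using divfree[OF t] by (simp add: divg_def)
  ultimately have "((\<lambda>s. 0::real) has_vector_derivative (\<Sum>j\<in>UNIV. px T k (px T j u) x t $ j)) (at 0)"
    by simp
  then have "(\<Sum>j\<in>UNIV. px T k (px T j u) x t $ j) = 0"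
    by (rule vector_derivative_unique_at[OF _ has_vector_derivative_const])
  then show ?thesis
    unfolding smooth_field_px_commute[OF u t, of k] .
qed

text \<open>Two swaps of adjacent derivatives; the second takes place under an outer
  \<open>px\<close> and therefore goes through \<open>px_cong\<close>.\<close>

lemma px3_commute:
  assumes t: "0 \<le> t" "t \<le> T"
  shows "px T k (px T j (px T j l)) x t = px T j (px T j (px T k l)) x t"
proof -
  have "px T k (px T j (px T j l)) x t = px T j (px T k (px T j l)) x t"
    by (rule smooth_field_px_commute[OF smooth_field_px[OF l] t])
  also have "\<dots> = px T j (px T j (px T k l)) x t"
    by (rule px_cong[OF smooth_field_px[OF smooth_field_px[OF l]] smooth_field_px[OF smooth_field_px[OF l]] t])
      (rule smooth_field_px_commute[OF l t])
  finally show ?thesis .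
qed

text \<open>The integrand of the \<open>H\<^sup>1\<close> identity, up to exact derivatives (\<open>Z\<close>). Two integrations by parts
  use \<open>div u = 0\<close> to move one derivative from the transport term onto \<open>u\<close>, leaving an undifferentiated
  \<open>l\<close> that the maximum principle controls.\<close>

lemma gradient_rate_pointwise:
  assumes t: "0 \<le> t" "t \<le> T" and K: "\<And>x. norm (l x t) \<le> K"
  shows "\<exists>Z. (Z has_integral 0) (cell L) \<and> (\<forall>x.
    (\<Sum>k\<in>UNIV. 2 * (px T k l x t \<bullet> pt T (px T k l) x t)) + \<nu> * (norm (lap T l x t))\<^sup>2
     \<le> Z x + 2 / \<nu> * (K\<^sup>2 * grad_sq T u x t + (norm (u x t))\<^sup>2))"
proof -
  \<comment> \<open>Index convention: in \<open>dU\<close> and \<open>ddU\<close> the last index is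
    the component of \<open>u\<close> and the others are directions; \<open>aaa j k\<close>
    differentiates twice along \<open>j\<close> and once along \<open>k\<close>.\<close>
  define a where "a k x = px T k l x t" for k x
  define aa where "aa j k x = px T j (px T k l) x t" for j k x
  define aaa where "aaa j k x = px T j (px T j (px T k l)) x t" for j k x
  define p where "p x = pt T l x t" for x
  define q where "q k x = px T k (pt T l) x t" for k x
  define U where "U j x = u x t $ j" for j x
  define dU where "dU k j x = px T k u x t $ j" for k j x
  define ddU where "ddU j k i x = px T j (px T k u) x t $ i" for j k i x
  note defs = a_def aa_def aaa_def p_def q_def U_def dU_def ddU_def
  define m where "m x = l x t" for x
  have aa_sym: "aa j k x = aa k j x" for j k x
    unfolding aa_def by (rule smooth_field_px_commute[OF l t])
  have pd_m: "pdiff L j m (a j)" for j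
    unfolding m_def a_def by (rule pdiff_field[OF l t])
  have pd_a: "pdiff L j (a k) (aa j k)" for j k
    unfolding a_def aa_def by (rule pdiff_field[OF smooth_field_px[OF l] t])
  have pd_aa: "pdiff L j (aa j k) (aaa j k)" for j k
    unfolding aaa_def aa_def by (rule pdiff_field[OF smooth_field_px[OF smooth_field_px[OF l]] t])
  \<comment> \<open>Writing this derivative as \<open>aaa j k\<close> makes the third-order terms of
    \<open>Z5\<close> and \<open>Z6\<close> coincide, so that they cancel in the difference.\<close>
  have pd_aa': "pdiff L k (aa j j) (aaa j k)" for j k
  proof -
    have "pdiff L k (aa j j) (\<lambda>x. px T k (px T j (px T j l)) x t)"
      unfolding aa_def by (rule pdiff_field[OF smooth_field_px[OF smooth_field_px[OF l]] t])
    then show ?thesis unfolding px3_commute[OF t] aaa_def .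
  qed
  have pd_p: "pdiff L k p (q k)" for k
    unfolding p_def q_def by (rule pdiff_field[OF smooth_field_pt[OF l pos(3)] t])
  have pd_U: "pdiff L k (U j) (dU k j)" for j k
    unfolding U_def dU_def by (rule pdiff_nth[OF pdiff_field[OF u t]])
  have pd_dU: "pdiff L j (dU k i) (ddU j k i)" for i j k
    unfolding dU_def ddU_def by (rule pdiff_nth[OF pdiff_field[OF smooth_field_px[OF u] t]])

  \<comment> \<open>Each is an exact derivative: \<open>Z1\<close> of \<open>a k \<bullet> p\<close>
    along \<open>k\<close>, \<open>Z2\<close> of \<open>U j * (a k \<bullet> a j)\<close> along
    \<open>k\<close>, \<open>Z3\<close> of \<open>U j * (a k \<bullet> a k)\<close> along
    \<open>j\<close>, \<open>Z4\<close> of \<open>dU k j * (a k \<bullet> m)\<close> along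
    \<open>j\<close>, \<open>Z5\<close> of \<open>a k \<bullet> aa j k\<close> along
    \<open>j\<close>, \<open>Z6\<close> of \<open>a k \<bullet> aa j j\<close> along
    \<open>k\<close>.\<close>
  define Z1 where "Z1 k x = a k x \<bullet> q k x + aa k k x \<bullet> p x" for k x
  define Z2 where "Z2 k j x = U j x * (a k x \<bullet> aa k j x + aa k k x \<bullet> a j x) + dU k j x * (a k x \<bullet> a j x)" for k j x
  define Z3 where "Z3 k j x = U j x * (a k x \<bullet> aa j k x + aa j k x \<bullet> a k x) + dU j j x * (a k x \<bullet> a k x)" for k j x
  define Z4 where "Z4 k j x = dU k j x * (a k x \<bullet> a j x + aa j k x \<bullet> m x) + ddU j k j x * (a k x \<bullet> m x)" for k j x
  define Z5 where "Z5 k j x = a k x \<bullet> aaa j k x + aa j k x \<bullet> aa j k x" for k j x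
  define Z6 where "Z6 k j x = a k x \<bullet> aaa j k x + aa k k x \<bullet> aa j j x" for k j x
  have Z: "(Z1 k has_integral 0) (cell L)" "(Z2 k j has_integral 0) (cell L)" "(Z3 k j has_integral 0) (cell L)"
     "(Z4 k j has_integral 0) (cell L)" "(Z5 k j has_integral 0) (cell L)" "(Z6 k j has_integral 0) (cell L)" for k j
    unfolding Z1_def Z2_def Z3_def Z4_def Z5_def Z6_def
    by (rule pdiff_has_integral[OF pdiff_inner[OF pd_a pd_p] pos(2)]
      pdiff_has_integral[OF pdiff_mult[OF pd_U pdiff_inner[OF pd_a pd_a]] pos(2)]
      pdiff_has_integral[OF pdiff_mult[OF pd_dU pdiff_inner[OF pd_a pd_m]] pos(2)]
      pdiff_has_integral[OF pdiff_inner[OF pd_a pd_aa] pos(2)]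
      pdiff_has_integral[OF pdiff_inner[OF pd_a pd_aa'] pos(2)])+
  define S where "S f = (\<Sum>k\<in>UNIV. \<Sum>j\<in>UNIV. f k j)" for f :: "3 \<Rightarrow> 3 \<Rightarrow> real"
  \<comment> \<open>The combination \<open>2 * Z2 - Z3 - 2 * Z4\<close> reduces twice the transport
    term to \<open>2 * W\<close> below, with \<open>R\<close> and \<open>V\<close> cancelling. The
    difference \<open>Z5 - Z6\<close> exchanges the squared Hessian \<open>Q\<close> for the squared
    Laplacian; its weight \<open>\<nu> / 2\<close> matches the Hessian part that Young's inequality
    produces from \<open>2 * W\<close>.\<close>
  define Z where "Z x = 2 * (\<Sum>k\<in>UNIV. Z1 k x) + (\<Sum>k\<in>UNIV. \<Sum>j\<in>UNIV.
      2 * Z2 k j x - Z3 k j x - 2 * Z4 k j x + \<nu> / 2 * (Z5 k j x - Z6 k j x))" for x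
  have "(Z has_integral (2 * (\<Sum>k\<in>(UNIV::3 set). 0) + (\<Sum>k\<in>(UNIV::3 set). \<Sum>j\<in>(UNIV::3 set).
      2 * 0 - 0 - 2 * 0 + \<nu> / 2 * (0 - 0)))) (cell L)"
    unfolding Z_def
    by (intro has_integral_add has_integral_diff has_integral_mult_right has_integral_sum Z finite)
  then have Z0: "(Z has_integral 0) (cell L)" by simp
  have "(\<Sum>k\<in>UNIV. 2 * (px T k l x t \<bullet> pt T (px T k l) x t)) + \<nu> * (norm (lap T l x t))\<^sup>2
     \<le> Z x + 2 / \<nu> * (K\<^sup>2 * grad_sq T u x t + (norm (u x t))\<^sup>2)" for x
  proof -
    define D where "D = lap T l x t"
    define W where "W = S (\<lambda>k j. dU k j x * (aa j k x \<bullet> m x))"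
    define V where "V = S (\<lambda>k j. dU k j x * (a k x \<bullet> a j x))"
    define R where "R = S (\<lambda>k j. U j x * (a k x \<bullet> aa j k x))"
    define Q where "Q = S (\<lambda>k j. aa j k x \<bullet> aa j k x)"
    have D: "D = (\<Sum>k\<in>UNIV. aa k k x)" by (simp add: D_def lap_def aa_def)
    have adv: "adv T u l x t = (\<Sum>j\<in>UNIV. U j x *\<^sub>R a j x)" by (simp add: adv_def U_def a_def)
    have p: "p x = \<nu> *\<^sub>R D - adv T u l x t - u x t"
    proof -
      have "p x = (pt T l x t + adv T u l x t - \<nu> *\<^sub>R lap T l x t + u x t) + (\<nu> *\<^sub>R lap T l x t - adv T u l x t - u x t)"
        by (simp add: p_def)
      then show ?thesis unfolding eqn[OF t] by (simp add: D_def)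
    qed
    have 1: "(\<Sum>k\<in>UNIV. 2 * (px T k l x t \<bullet> pt T (px T k l) x t)) = 2 * (\<Sum>k\<in>UNIV. Z1 k x) - 2 * (D \<bullet> p x)"
    proof -
      have "(\<Sum>k\<in>UNIV. Z1 k x) = (\<Sum>k\<in>UNIV. px T k l x t \<bullet> pt T (px T k l) x t) + D \<bullet> p x"
        by (simp add: Z1_def sum.distrib D inner_sum_left a_def q_def smooth_field_pt_px_commute[OF l pos(3) t])
      then show ?thesis by (simp add: sum_distrib_left)
    qed
    \<comment> \<open>The dissipation \<open>2 * \<nu> * (D \<bullet> D)\<close> is spent as
      follows: \<open>\<nu>\<close> is the Laplacian term of the claim, \<open>\<nu> / 2\<close>
      absorbs the source term and \<open>\<nu> / 2\<close> absorbs the Hessian coming from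
      \<open>W\<close>.\<close>
    have 2: "- 2 * (D \<bullet> p x) = - 2 * \<nu> * (D \<bullet> D) + 2 * (D \<bullet> adv T u l x t) + 2 * (D \<bullet> u x t)"
      unfolding p by (simp add: inner_diff_right algebra_simps)
    have "S (\<lambda>k j. Z2 k j x) = R + D \<bullet> adv T u l x t + V"
    proof -
      have "D \<bullet> adv T u l x t = S (\<lambda>k j. U j x * (aa k k x \<bullet> a j x))"
        unfolding D adv S_def inner_sum_left inner_sum_right inner_scaleR_right sum_distrib_left by (rule sum.swap)
      then show ?thesis
        by (simp add: R_def V_def S_def Z2_def sum.distrib distrib_left aa_sym[of _ _ x])
    qed
    moreover have "S (\<lambda>k j. Z3 k j x) = 2 * R"
    proof -
      have "S (\<lambda>k j. dU j j x * (a k x \<bullet> a k x)) = 0"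
        using divfree[OF t, of x] by (simp add: S_def dU_def divg_def sum_distrib_right[symmetric])
      moreover have "S (\<lambda>k j. Z3 k j x) = 2 * R + S (\<lambda>k j. dU j j x * (a k x \<bullet> a k x))"
        by (simp add: R_def S_def Z3_def sum.distrib distrib_left sum_distrib_left inner_commute[of "aa _ _ x" "a _ x"] mult.left_commute[of _ 2])
      ultimately show ?thesis by simp
    qed
    moreover have "S (\<lambda>k j. Z4 k j x) = V + W"
    proof -
      have "S (\<lambda>k j. ddU j k j x * (a k x \<bullet> m x)) = 0"
        using sum_px_px_u_zero[OF t] by (simp add: S_def ddU_def sum_distrib_right[symmetric])
      then show ?thesis
        by (simp add: V_def W_def S_def Z4_def sum.distrib distrib_left)
    qed
    moreover have "S (\<lambda>k j. Z5 k j x) - S (\<lambda>k j. Z6 k j x) = Q - D \<bullet> D"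
      by (simp add: S_def Z5_def Z6_def sum.distrib Q_def D inner_sum_left inner_sum_right) (rule sum.swap)
    moreover have "Z x = 2 * (\<Sum>k\<in>UNIV. Z1 k x) + 2 * S (\<lambda>k j. Z2 k j x) - S (\<lambda>k j. Z3 k j x) - 2 * S (\<lambda>k j. Z4 k j x)
        + \<nu> / 2 * (S (\<lambda>k j. Z5 k j x) - S (\<lambda>k j. Z6 k j x))"
      by (simp add: Z_def S_def sum.distrib sum_subtractf sum_distrib_left right_diff_distrib)
    moreover have "W \<le> \<nu> / 4 * Q + K\<^sup>2 / \<nu> * grad_sq T u x t"
    proof -
      have summand: "dU k j x * (aa j k x \<bullet> m x) \<le> \<nu> / 4 * (aa j k x \<bullet> aa j k x) + K\<^sup>2 / \<nu> * (dU k j x)\<^sup>2" for k j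
      proof -
        have "dU k j x * (aa j k x \<bullet> m x) \<le> \<bar>dU k j x\<bar> * \<bar>aa j k x \<bullet> m x\<bar>"
          by (metis abs_ge_self abs_mult)
        also have "\<dots> \<le> \<bar>dU k j x\<bar> * (norm (aa j k x) * K)"
          by (intro mult_left_mono order_trans[OF Cauchy_Schwarz_ineq2]) (simp_all add: K m_def)
        also have "\<dots> = 2 * norm (aa j k x) * (\<bar>dU k j x\<bar> * K / 2)" by simp
        also have "\<dots> \<le> \<nu> / 4 * (norm (aa j k x))\<^sup>2 + (\<bar>dU k j x\<bar> * K / 2)\<^sup>2 / (\<nu> / 4)"
          by (rule young) (use pos in simp)
        also have "\<dots> = \<nu> / 4 * (aa j k x \<bullet> aa j k x) + K\<^sup>2 / \<nu> * (dU k j x)\<^sup>2"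
          by (simp add: dot_square_norm power_mult_distrib power_divide)
        finally show ?thesis .
      qed
      have "W \<le> S (\<lambda>k j. \<nu> / 4 * (aa j k x \<bullet> aa j k x) + K\<^sup>2 / \<nu> * (dU k j x)\<^sup>2)"
        unfolding W_def S_def by (intro sum_mono summand)
      also have "\<dots> = \<nu> / 4 * Q + K\<^sup>2 / \<nu> * S (\<lambda>k j. (dU k j x)\<^sup>2)"
        by (simp add: S_def Q_def sum.distrib sum_distrib_left)
      also have "S (\<lambda>k j. (dU k j x)\<^sup>2) = grad_sq T u x t"
        by (simp add: S_def grad_sq_inner dU_def inner_vec_def power2_eq_square)
      finally show ?thesis .
    qed
    moreover have "D \<bullet> u x t \<le> \<nu> / 4 * (D \<bullet> D) + (norm (u x t))\<^sup>2 / \<nu>"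
    proof -
      have "D \<bullet> u x t \<le> 2 * norm D * (norm (u x t) / 2)"
        using norm_cauchy_schwarz[of D "u x t"] by simp
      also have "\<dots> \<le> \<nu> / 4 * (norm D)\<^sup>2 + (norm (u x t) / 2)\<^sup>2 / (\<nu> / 4)"
        by (rule young) (use pos in simp)
      finally show ?thesis by (simp add: dot_square_norm power_divide)
    qed
    ultimately have "(\<Sum>k\<in>UNIV. 2 * (px T k l x t \<bullet> pt T (px T k l) x t)) + \<nu> * (D \<bullet> D)
        \<le> Z x + 2 * (K\<^sup>2 / \<nu> * grad_sq T u x t) + 2 * ((norm (u x t))\<^sup>2 / \<nu>)"
      using 1 2 by (simp add: right_diff_distrib)
    then show ?thesis
      by (simp add: D_def dot_square_norm distrib_left mult.assoc)
  qed
  with Z0 show ?thesis by blast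
qed

text \<open>Integrating the pointwise inequality over the cell removes \<open>Z\<close>. In time,
  the right-hand side minus the left-hand side is then nondecreasing and starts from zero.\<close>

lemma gradient_bound:
  assumes t: "0 \<le> t" "t \<le> T" and K: "\<And>x s. 0 \<le> s \<Longrightarrow> s \<le> t \<Longrightarrow> norm (l x s) \<le> K"
  shows "CI (\<lambda>x. grad_sq T l x t) + \<nu> * integral {0..t} (\<lambda>s. CI (\<lambda>x. (norm (lap T l x s))\<^sup>2))
    \<le> 2 / \<nu> * (K\<^sup>2 * integral {0..t} (\<lambda>s. CI (\<lambda>x. grad_sq T u x s))
        + integral {0..t} (\<lambda>s. CI (\<lambda>x. (norm (u x s))\<^sup>2)))"
proof -
  define g where "g s = CI (\<lambda>x. grad_sq T l x s)" for s
  define g' where "g' s = CI (\<lambda>x. \<Sum>k\<in>UNIV. 2 * (px T k l x s \<bullet> pt T (px T k l) x s))" for s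
  define d where "d s = CI (\<lambda>x. (norm (lap T l x s))\<^sup>2)" for s
  define gu where "gu s = CI (\<lambda>x. grad_sq T u x s)" for s
  define e where "e s = CI (\<lambda>x. (norm (u x s))\<^sup>2)" for s
  have cont: "continuous_on {0..T} d" "continuous_on {0..T} gu" "continuous_on {0..T} e"
    unfolding d_def gu_def e_def
    by (rule continuous_on_cell_integral, intro continuous_on_grad_sq_lap continuous_on_power continuous_on_norm
        smooth_field_continuous[OF u] l u slice_ranges; assumption)+
  have g_deriv: "(g has_real_derivative g' s) (at s within {0..T})" if s: "0 \<le> s" "s \<le> T" for s
    unfolding g_def g'_def
  proof (rule cell_integral_time_deriv[OF _ _ _ s])
    show "((\<lambda>s. grad_sq T l x s) has_vector_derivative (\<Sum>k\<in>UNIV. 2 * (px T k l x s \<bullet> pt T (px T k l) x s))) (at s within {0..T})"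
      if s: "0 \<le> s" "s \<le> T" for x s
      unfolding grad_sq_inner
    proof (rule has_vector_derivative_sum)
      fix k :: 3
      note d = smooth_field_pt_deriv[OF smooth_field_px[OF l] s, of k x]
      show "((\<lambda>s. px T k l x s \<bullet> px T k l x s) has_vector_derivative 2 * (px T k l x s \<bullet> pt T (px T k l) x s)) (at s within {0..T})"
        using bounded_bilinear.has_vector_derivative[OF bounded_bilinear_inner d d]
        by (simp add: inner_commute)
    qed
    show "continuous_on UNIV (\<lambda>x. grad_sq T l x s)" if "0 \<le> s" "s \<le> T" for s
      using that by (intro continuous_on_grad_sq_lap l continuous_on_id continuous_on_const) auto
    show "continuous_on ({0..T} \<times> cell L) (\<lambda>z. \<Sum>k\<in>UNIV. 2 * (px T k l (snd z) (fst z) \<bullet> pt T (px T k l) (snd z) (fst z)))"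
      by (intro continuous_on_sum continuous_on_mult continuous_on_const continuous_on_inner
          smooth_field_continuous[OF smooth_field_px[OF l]]
          smooth_field_continuous[OF smooth_field_pt[OF smooth_field_px[OF l] pos(3)]] slice_ranges)
  qed
  have rate: "g' s + \<nu> * d s \<le> 2 / \<nu> * (K\<^sup>2 * gu s + e s)" if s: "0 \<le> s" "s \<le> t" for s
  proof -
    have s': "s \<le> T" using s t by simp
    obtain Z where Z: "(Z has_integral 0) (cell L)"
      and le: "\<And>x. (\<Sum>k\<in>UNIV. 2 * (px T k l x s \<bullet> pt T (px T k l) x s)) + \<nu> * (norm (lap T l x s))\<^sup>2
       \<le> Z x + 2 / \<nu> * (K\<^sup>2 * grad_sq T u x s + (norm (u x s))\<^sup>2)"
      using gradient_rate_pointwise[OF s(1) s' K[OF s]] by blast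
    have c: "continuous_on UNIV (\<lambda>x. (\<Sum>k\<in>UNIV. 2 * (px T k l x s \<bullet> pt T (px T k l) x s)))"
      "continuous_on UNIV (\<lambda>x. (norm (lap T l x s))\<^sup>2)"
      "continuous_on UNIV (\<lambda>x. grad_sq T u x s)" "continuous_on UNIV (\<lambda>x. (norm (u x s))\<^sup>2)"
      by (intro continuous_on_sum continuous_on_mult continuous_on_const continuous_on_inner continuous_on_power continuous_on_norm
          slice_continuous[OF smooth_field_px[OF l] s(1) s'] slice_continuous[OF u s(1) s']
          slice_continuous[OF smooth_field_pt[OF smooth_field_px[OF l] pos(3)] s(1) s'] continuous_on_grad_sq_lap l u continuous_on_id;
          use s s' in simp)+
    note h = integrable_integral[OF continuous_integrable_on_cell[of _ L]]
    have "((\<lambda>x. (\<Sum>k\<in>UNIV. 2 * (px T k l x s \<bullet> pt T (px T k l) x s)) + \<nu> * (norm (lap T l x s))\<^sup>2)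
        has_integral g' s + \<nu> * d s) (cell L)"
      unfolding g'_def d_def by (intro has_integral_add has_integral_mult_right h c)
    moreover have "((\<lambda>x. Z x + 2 / \<nu> * (K\<^sup>2 * grad_sq T u x s + (norm (u x s))\<^sup>2))
        has_integral 0 + 2 / \<nu> * (K\<^sup>2 * gu s + e s)) (cell L)"
      unfolding gu_def e_def by (intro has_integral_add has_integral_mult_right Z h c)
    ultimately have "g' s + \<nu> * d s \<le> 0 + 2 / \<nu> * (K\<^sup>2 * gu s + e s)"
      by (rule has_integral_le) (rule le)
    then show ?thesis by simp
  qed
  let ?\<Phi> = "\<lambda>s. 2 / \<nu> * (K\<^sup>2 * integral {0..s} gu + integral {0..s} e) - g s - \<nu> * integral {0..s} d"
  have "?\<Phi> 0 \<le> ?\<Phi> t"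
  proof (rule nondecreasing_from_within_deriv[OF t])
    fix s assume s: "0 \<le> s" "s \<le> t"
    then have s': "s \<le> T" using t by simp
    show "(?\<Phi> has_real_derivative 2 / \<nu> * (K\<^sup>2 * gu s + e s) - g' s - \<nu> * d s) (at s within {0..T})"
      by (intro DERIV_diff DERIV_add DERIV_cmult g_deriv time_integral_deriv cont s(1) s')
    show "0 \<le> 2 / \<nu> * (K\<^sup>2 * gu s + e s) - g' s - \<nu> * d s"
      using rate[OF s] by simp
  qed
  moreover have "g 0 = 0"
  proof -
    \<comment> \<open>The spatial derivative at time \<open>0\<close> is determined by the slice
      there, which vanishes by \<open>init\<close>.\<close>
    have "px T k l x 0 = 0" for k x
    proof (rule vector_derivative_unique_at)
      show "((\<lambda>s. l (x + s *\<^sub>R axis k 1) 0) has_vector_derivative px T k l x 0) (at 0)"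
        using smooth_field_px_deriv[OF l _ _, of 0 x k 0 UNIV] pos(3) by simp
      show "((\<lambda>s. l (x + s *\<^sub>R axis k 1) 0) has_vector_derivative 0) (at 0)"
        by (simp add: init)
    qed
    then show ?thesis by (simp add: g_def grad_sq_def)
  qed
  ultimately show ?thesis
    unfolding g_def[symmetric] d_def[symmetric] gu_def[symmetric] e_def[symmetric] by simp
qed

end

section \<open>Fourier coefficients of smooth periodic fields\<close>

text \<open>The product form makes sums over cubes of the lattice factor into one-dimensional sums.
  It is applied with \<open>c = (2 * pi / L)\<^sup>2\<close>.\<close>

definition lattice_decay :: "real \<Rightarrow> int^3 \<Rightarrow> real" where
  "lattice_decay c k = (\<Prod>j\<in>UNIV. 1 / (1 + c * (real_of_int (k $ j))\<^sup>2))"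

lemma summable_on_int_inverse_square:
  assumes c: "c > 0"
  shows "(\<lambda>n::int. 1 / (1 + c * (real_of_int n)\<^sup>2)) summable_on UNIV"
proof -
  let ?h = "\<lambda>n::int. 1 / (1 + c * (real_of_int n)\<^sup>2)"
  have "summable (\<lambda>n::nat. 1 / (1 + c * (real n)\<^sup>2))"
  proof (rule summable_comparison_test')
    show "summable (\<lambda>n. 1 / c * inverse ((real n)\<^sup>2))"
      by (rule summable_mult) (use inverse_power_summable[of 2, where 'a = real] in simp)
    show "norm (1 / (1 + c * (real n)\<^sup>2)) \<le> 1 / c * inverse ((real n)\<^sup>2)" if "n \<ge> 1" for n
    proof -
      have p: "0 < c * (real n)\<^sup>2" using c that by simp
      then have "1 / (1 + c * (real n)\<^sup>2) \<le> 1 / (c * (real n)\<^sup>2)" by (intro divide_left_mono) auto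
      then show ?thesis using p by (simp add: inverse_eq_divide)
    qed
  qed
  then have nat: "(\<lambda>n::nat. 1 / (1 + c * (real n)\<^sup>2)) summable_on UNIV"
    by (rule summable_nonneg_imp_summable_on) (use c in simp)
  have "?h summable_on range int"
    using nat by (subst summable_on_reindex) (auto simp: o_def)
  moreover have "?h summable_on range (\<lambda>n. - int n)"
    using nat by (subst summable_on_reindex) (auto simp: o_def inj_def)
  ultimately have "?h summable_on (range int \<union> range (\<lambda>n. - int n))"
    by (rule summable_on_union)
  moreover have "range int \<union> range (\<lambda>n. - int n) = UNIV"
  proof (rule UNIV_eq_I[symmetric])
    show "n \<in> range int \<union> range (\<lambda>n. - int n)" for n :: int
      by (cases n rule: int_cases2) auto
  qed
  ultimately show ?thesis by simp
qed

text \<open>Bounded finite sums suffice for a nonnegative family. Any finite set of lattice points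
  lies in a finite cube, over which the sum is the third power of a one-dimensional sum.\<close>

lemma summable_on_lattice_decay:
  assumes c: "c > 0"
  shows "lattice_decay c summable_on X"
proof -
  define h where "h n = 1 / (1 + c * (real_of_int n)\<^sup>2)" for n
  have h0: "h n \<ge> 0" for n using c by (simp add: h_def)
  have decay: "lattice_decay c k = (\<Prod>j\<in>UNIV. h (k $ j))" for k
    by (simp add: lattice_decay_def h_def)
  have hs: "h summable_on UNIV"
    using summable_on_int_inverse_square[OF c] unfolding h_def .
  have bound: "sum (lattice_decay c) Y \<le> (infsum h UNIV) ^ 3" if fin: "finite Y" for Y
  proof -
    \<comment> \<open>All coordinates occurring in \<open>Y\<close>, in any direction, so that one
      set serves as every side of the cube.\<close>
    define B where "B = (\<Union>j. (\<lambda>k. k $ j) ` Y)"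
    have B: "finite B" using fin by (simp add: B_def)
    have "Y \<subseteq> vec_lambda ` PiE UNIV (\<lambda>j. B)"
    proof
      fix k assume "k \<in> Y"
      then have "(\<lambda>j. k $ j) \<in> PiE UNIV (\<lambda>j. B)" by (auto simp: B_def)
      then show "k \<in> vec_lambda ` PiE UNIV (\<lambda>j. B)"
        by (intro image_eqI[where x = "\<lambda>j. k $ j"]) simp_all
    qed
    then have "sum (lattice_decay c) Y \<le> sum (lattice_decay c) (vec_lambda ` PiE UNIV (\<lambda>j. B))"
      using B by (intro sum_mono2 finite_imageI finite_PiE) (auto simp: decay h0 intro: prod_nonneg)
    also have "\<dots> = (\<Sum>g\<in>PiE (UNIV :: 3 set) (\<lambda>j. B). \<Prod>j\<in>UNIV. h (g j))"
      by (subst sum.reindex) (auto simp: decay inj_on_def vec_lambda_inject)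
    also have "\<dots> = (\<Prod>j\<in>(UNIV::3 set). sum h B)"
      by (rule prod_sum_PiE[symmetric]) (use B in auto)
    also have "\<dots> = (sum h B) ^ 3" by simp
    also have "\<dots> \<le> (infsum h UNIV) ^ 3"
      by (intro power_mono sum_nonneg finite_sum_le_infsum[OF hs B]) (use h0 in auto)
    finally show ?thesis .
  qed
  show ?thesis
    by (rule nonneg_bdd_above_summable_on)
      (use bound in \<open>auto simp: decay h0 bdd_above_def intro!: prod_nonneg\<close>)
qed

section \<open>Plane waves and the decay of Fourier coefficients\<close>

definition wave :: "real \<Rightarrow> int^3 \<Rightarrow> real^3 \<Rightarrow> complex" where
  "wave L k x = cis (- 2 * pi * (kvec k \<bullet> x) / L)"

lemma kvec_axis: "kvec k \<bullet> (x + s *\<^sub>R axis j 1) = kvec k \<bullet> x + s * of_int (k $ j)"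
  by (simp add: inner_add_right inner_axis kvec_def)

lemma pdiff_wave:
  assumes "L > 0"
  shows "pdiff L j (wave L k) (\<lambda>x. (- 2 * pi * of_int (k $ j) / L) *\<^sub>R (\<i> * wave L k x))"
  unfolding pdiff_def
proof (intro conjI allI)
  show cont: "continuous_on UNIV (wave L k)"
    unfolding wave_def by (intro continuous_intros) (use assms in auto)
  then show "continuous_on UNIV (\<lambda>x. (- 2 * pi * of_int (k $ j) / L) *\<^sub>R (\<i> * wave L k x))"
    by (intro continuous_intros) simp
  show "periodic L (wave L k)"
    unfolding periodic_def
  proof (intro allI)
    fix x :: "real^3" and i :: 3
    \<comment> \<open>A shift by \<open>L\<close> changes the phase by an integer multiple of
      \<open>2 * pi\<close>.\<close>
    have eq: "- 2 * pi * (kvec k \<bullet> (x + L *\<^sub>R axis i 1)) / L = - 2 * pi * (kvec k \<bullet> x) / L + 2 * pi * of_int (- (k $ i))"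
      using assms by (simp add: kvec_axis field_simps)
    then show "wave L k (x + L *\<^sub>R axis i 1) = wave L k x"
      unfolding wave_def eq cis_mult[symmetric] using cis_multiple_2pi[of "of_int (- (k $ i))"] by simp
  qed
  fix x :: "real^3"
  have "(\<lambda>h. - 2 * pi * (kvec k \<bullet> (x + h *\<^sub>R axis j 1)) / L)
      = (\<lambda>h. - 2 * pi * (kvec k \<bullet> x) / L + h * (- 2 * pi * of_int (k $ j) / L))"
    using assms by (simp add: kvec_axis fun_eq_iff field_simps)
  moreover have "((\<lambda>h. a + h * b) has_derivative (\<lambda>h. h * b)) (at 0)" for a b :: real
    by (auto intro!: derivative_eq_intros)
  ultimately have "((\<lambda>h. - 2 * pi * (kvec k \<bullet> (x + h *\<^sub>R axis j 1)) / L) has_derivative (\<lambda>h. h * (- 2 * pi * of_int (k $ j) / L))) (at 0)"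
    by (simp only:)
  from has_derivative_cis[OF this]
  show "((\<lambda>h. wave L k (x + h *\<^sub>R axis j 1)) has_vector_derivative
      (- 2 * pi * of_int (k $ j) / L) *\<^sub>R (\<i> * wave L k x)) (at 0)"
    by (simp add: wave_def has_vector_derivative_def)
qed

text \<open>For continuous \<open>g\<close> this is \<open>fcoef\<close> without its factor
  \<open>1 / L ^ 3\<close>, taken as a gauge integral so that the \<open>pdiff\<close> calculus
  applies.\<close>

definition wave_int :: "real \<Rightarrow> (real^3 \<Rightarrow> real) \<Rightarrow> int^3 \<Rightarrow> complex" where
  "wave_int L g k = integral (cell L) (\<lambda>x. complex_of_real (g x) * wave L k x)"

lemma norm_wave [simp]: "norm (wave L k x) = 1"
  by (simp add: wave_def)

lemma continuous_on_wave: "continuous_on X (wave L k)"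
proof (cases "L = 0")
  case False
  then show ?thesis unfolding wave_def by (intro continuous_intros) auto
qed (simp add: wave_def[abs_def] continuous_on_const)

lemma fcoef_eq_wave_int:
  assumes "continuous_on UNIV g"
  shows "fcoef L g k = 1 / complex_of_real L ^ 3 * wave_int L g k"
proof -
  have "continuous_on (cell L) (\<lambda>x. complex_of_real (g x) * wave L k x)"
    by (intro continuous_on_mult continuous_on_of_real continuous_on_wave continuous_on_subset[OF assms]) simp
  from sint_eq_integral[OF this]
  show ?thesis by (simp add: fcoef_def sint_def wave_int_def wave_def)
qed

lemma pdiff_bounded_linear:
  assumes "bounded_linear f" "pdiff L j g g'"
  shows "pdiff L j (\<lambda>x. f (g x)) (\<lambda>x. f (g' x))"
  unfolding pdiff_def periodic_def
  by (intro conjI allI bounded_linear.continuous_on[OF assms(1)] bounded_linear.has_vector_derivative[OF assms(1)])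
    (use assms(2) in \<open>auto simp: pdiff_def periodic_def\<close>)

text \<open>Integration by parts against the wave, with only moduli kept; periodicity leaves no
  boundary term.\<close>

lemma norm_wave_int_deriv:
  assumes L: "L > 0" and g: "pdiff L j g g'"
  shows "norm (wave_int L g' k) = 2 * pi * \<bar>of_int (k $ j)\<bar> / L * norm (wave_int L g k)"
proof -
  let ?c = "- 2 * pi * of_int (k $ j) / L"
  have cont: "continuous_on UNIV g" "continuous_on UNIV g'" using g by (auto simp: pdiff_def)
  have int: "(\<lambda>x. complex_of_real (g x) * wave L k x) integrable_on cell L"
    "(\<lambda>x. complex_of_real (g' x) * wave L k x) integrable_on cell L"
    by (intro continuous_integrable_on_cell continuous_on_mult continuous_on_of_real continuous_on_wave cont)+
  have 1: "((\<lambda>x. complex_of_real (g x) * (?c *\<^sub>R (\<i> * wave L k x)) + complex_of_real (g' x) * wave L k x) has_integral 0) (cell L)"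
    by (rule pdiff_has_integral[OF pdiff_mult[OF pdiff_bounded_linear[OF bounded_linear_of_real g] pdiff_wave[OF L]] L])
  have 2: "((\<lambda>x. (?c *\<^sub>R \<i>) * (complex_of_real (g x) * wave L k x) + complex_of_real (g' x) * wave L k x)
      has_integral (?c *\<^sub>R \<i>) * wave_int L g k + wave_int L g' k) (cell L)"
    unfolding wave_int_def
    by (intro has_integral_add has_integral_mult_right integrable_integral int)
  have 3: "(\<lambda>x. complex_of_real (g x) * (?c *\<^sub>R (\<i> * wave L k x)) + complex_of_real (g' x) * wave L k x)
      = (\<lambda>x. (?c *\<^sub>R \<i>) * (complex_of_real (g x) * wave L k x) + complex_of_real (g' x) * wave L k x)"
    by (simp add: fun_eq_iff)
  have "(?c *\<^sub>R \<i>) * wave_int L g k + wave_int L g' k = 0"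
    by (rule has_integral_unique[OF 2 1[unfolded 3]])
  then have "wave_int L g' k = - ((?c *\<^sub>R \<i>) * wave_int L g k)"
    by (rule minus_unique[symmetric])
  then have "norm (wave_int L g' k) = \<bar>?c\<bar> * norm (wave_int L g k)"
    by (simp only: norm_minus_cancel norm_mult norm_scaleR norm_ii mult_1_right)
  also have "\<bar>?c\<bar> = 2 * pi * \<bar>of_int (k $ j)\<bar> / L"
    using L by (simp add: abs_mult)
  finally show ?thesis .
qed

lemma norm_wave_int_le:
  assumes g: "continuous_on UNIV g" and M: "M \<ge> 0" "\<And>x. \<bar>g x\<bar> \<le> M"
  shows "norm (wave_int L g k) \<le> M * measure lborel (cell L)"
  unfolding cell_def
proof (rule has_integral_bound[OF M(1)])
  have "(\<lambda>x. complex_of_real (g x) * wave L k x) integrable_on cell L"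
    by (intro continuous_integrable_on_cell continuous_on_mult continuous_on_of_real continuous_on_wave g)
  then show "((\<lambda>x. complex_of_real (g x) * wave L k x) has_integral wave_int L g k) (cbox 0 (\<chi> i. L))"
    by (simp add: wave_int_def integrable_integral cell_def)
qed (use M in \<open>simp add: norm_mult\<close>)

text \<open>Integrating by parts twice in direction \<open>j\<close> gains a factor \<open>1 + (2 \<pi> k\<^sub>j / L)\<^sup>2\<close>.\<close>

lemma wave_int_decay_list:
  fixes F :: "real^3 \<Rightarrow> real \<Rightarrow> real^3"
  assumes L: "L > 0" and F: "smooth_field L T F"
  shows "\<exists>M. \<forall>k s. 0 \<le> s \<longrightarrow> s \<le> T \<longrightarrow>
    (\<Prod>j\<leftarrow>js. 1 + (2 * pi / L)\<^sup>2 * (of_int (k $ j))\<^sup>2) * norm (wave_int L (\<lambda>y. F y s $ i) k) \<le> M"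
  using F
proof (induction js arbitrary: F)
  case Nil
  obtain M where M: "M \<ge> 0" "\<And>x t. 0 \<le> t \<Longrightarrow> t \<le> T \<Longrightarrow> norm (F x t) \<le> M"
    using smooth_field_bounded[OF Nil L] by blast
  have "norm (wave_int L (\<lambda>y. F y s $ i) k) \<le> M * measure lborel (cell L)" if "0 \<le> s" "s \<le> T" for k s
  proof (rule norm_wave_int_le[OF _ M(1)])
    show "continuous_on UNIV (\<lambda>y. F y s $ i)"
      using pdiff_nth[OF pdiff_field[OF Nil that]] by (simp add: pdiff_def)
    show "\<bar>F x s $ i\<bar> \<le> M" for x
      using component_le_norm_cart[of "F x s" i] M(2)[OF that, of x] by linarith
  qed
  then show ?case by auto
next
  case (Cons j js)
  let ?P = "\<lambda>k. \<Prod>j\<leftarrow>js. 1 + (2 * pi / L)\<^sup>2 * (of_int (k $ j))\<^sup>2"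
  let ?F2 = "px T j (px T j F)"
  obtain M1 where M1: "\<And>k s. 0 \<le> s \<Longrightarrow> s \<le> T \<Longrightarrow> ?P k * norm (wave_int L (\<lambda>y. F y s $ i) k) \<le> M1"
    using Cons.IH[OF Cons.prems] by blast
  \<comment> \<open>The induction hypothesis is also applied to the second derivative of
    \<open>F\<close>, hence the generalisation over \<open>F\<close>.\<close>
  obtain M2 where M2: "\<And>k s. 0 \<le> s \<Longrightarrow> s \<le> T \<Longrightarrow> ?P k * norm (wave_int L (\<lambda>y. ?F2 y s $ i) k) \<le> M2"
    using Cons.IH[OF smooth_field_px[OF smooth_field_px[OF Cons.prems]]] by blast
  have "(\<Prod>j\<leftarrow>j # js. 1 + (2 * pi / L)\<^sup>2 * (of_int (k $ j))\<^sup>2) * norm (wave_int L (\<lambda>y. F y s $ i) k) \<le> M1 + M2"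
    if s: "0 \<le> s" "s \<le> T" for k s
  proof -
    have "norm (wave_int L (\<lambda>y. ?F2 y s $ i) k) = 2 * pi * \<bar>of_int (k $ j)\<bar> / L * norm (wave_int L (\<lambda>y. px T j F y s $ i) k)"
      by (rule norm_wave_int_deriv[OF L pdiff_nth[OF pdiff_field[OF smooth_field_px[OF Cons.prems] s]]])
    also have "norm (wave_int L (\<lambda>y. px T j F y s $ i) k) = 2 * pi * \<bar>of_int (k $ j)\<bar> / L * norm (wave_int L (\<lambda>y. F y s $ i) k)"
      by (rule norm_wave_int_deriv[OF L pdiff_nth[OF pdiff_field[OF Cons.prems s]]])
    also have "2 * pi * \<bar>of_int (k $ j)\<bar> / L * (2 * pi * \<bar>of_int (k $ j)\<bar> / L * norm (wave_int L (\<lambda>y. F y s $ i) k))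
        = (2 * pi / L)\<^sup>2 * (of_int (k $ j))\<^sup>2 * norm (wave_int L (\<lambda>y. F y s $ i) k)"
      by (simp add: power2_eq_square)
    finally have "(\<Prod>j\<leftarrow>j # js. 1 + (2 * pi / L)\<^sup>2 * (of_int (k $ j))\<^sup>2) * norm (wave_int L (\<lambda>y. F y s $ i) k)
      = ?P k * norm (wave_int L (\<lambda>y. F y s $ i) k) + ?P k * norm (wave_int L (\<lambda>y. ?F2 y s $ i) k)"
      by (simp add: distrib_right distrib_left)
    then show ?thesis using M1[OF s, of k] M2[OF s, of k] by simp
  qed
  then show ?case by blast
qed

text \<open>The bound \<open>M\<close> is uniform in time as well as in frequency, as a majorant for
  the Fourier series must be.\<close>

lemma wave_int_decay:
  fixes F :: "real^3 \<Rightarrow> real \<Rightarrow> real^3"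
  assumes L: "L > 0" and F: "smooth_field L T F"
  obtains M where "\<And>k s. 0 \<le> s \<Longrightarrow> s \<le> T \<Longrightarrow>
    norm (wave_int L (\<lambda>y. F y s $ i) k) \<le> M * lattice_decay ((2 * pi / L)\<^sup>2) k"
proof -
  let ?w = "\<lambda>k j. 1 + (2 * pi / L)\<^sup>2 * (real_of_int (k $ j))\<^sup>2"
  \<comment> \<open>Every axis occurs exactly once, so two integrations by parts are spent in each
    direction and the list product is the one in \<open>lattice_decay\<close>.\<close>
  obtain js :: "3 list" where js: "set js = UNIV" "distinct js"
    using finite_distinct_list[OF finite_class.finite_UNIV] by blast
  obtain M where M: "\<And>k s. 0 \<le> s \<Longrightarrow> s \<le> T \<Longrightarrow>
      (\<Prod>j\<leftarrow>js. ?w k j) * norm (wave_int L (\<lambda>y. F y s $ i) k) \<le> M"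
    using wave_int_decay_list[OF L F, of js i] by blast
  have "norm (wave_int L (\<lambda>y. F y s $ i) k) \<le> M * lattice_decay ((2 * pi / L)\<^sup>2) k" if s: "0 \<le> s" "s \<le> T" for k s
  proof -
    have pos: "?w k j > 0" for j by (intro add_pos_nonneg) simp_all
    have P: "(\<Prod>j\<leftarrow>js. ?w k j) = (\<Prod>j\<in>UNIV. ?w k j)"
      using prod.distinct_set_conv_list[OF js(2)] js(1) by metis
    have "(\<Prod>j\<in>UNIV. ?w k j) > 0" by (rule prod_pos) (use pos in simp)
    then have "norm (wave_int L (\<lambda>y. F y s $ i) k) \<le> M / (\<Prod>j\<in>UNIV. ?w k j)"
      using M[OF s, of k] unfolding P by (subst pos_le_divide_eq) (simp_all only: mult.commute)
    also have "\<dots> = M * lattice_decay ((2 * pi / L)\<^sup>2) k"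
      by (simp add: lattice_decay_def prod_dividef)
    finally show ?thesis .
  qed
  then show ?thesis by (rule that)
qed

text \<open>Keeps the multiplier in \<open>neg_lap_inv_sqrt\<close> at most
  \<open>L / (2 * pi)\<close> on the nonzero frequencies.\<close>

lemma norm_kvec_ge_1:
  assumes "k \<noteq> 0"
  shows "norm (kvec k) \<ge> 1"
proof -
  obtain j where "k $ j \<noteq> 0" using assms by (auto simp: vec_eq_iff)
  then have "1 \<le> \<bar>real_of_int (k $ j)\<bar>" by linarith
  also have "\<dots> \<le> norm (kvec k)" using component_le_norm_cart[of "kvec k" j] by (simp add: kvec_def)
  finally show ?thesis .
qed

lemma continuous_on_wave_int:
  fixes F :: "real^3 \<Rightarrow> real \<Rightarrow> real^3"
  assumes F: "smooth_field L T F"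
  shows "continuous_on {0..T} (\<lambda>s. wave_int L (\<lambda>y. F y s $ i) k)"
  unfolding wave_int_def
proof (rule continuous_on_cell_integral)
  have "continuous_on ({0..T} \<times> cell L) (\<lambda>z. F (snd z) (fst z))"
    by (rule smooth_field_continuous[OF F]) (auto intro: continuous_on_fst continuous_on_snd continuous_on_id)
  then show "continuous_on ({0..T} \<times> cell L) (\<lambda>z. complex_of_real (F (snd z) (fst z) $ i) * wave L k (snd z))"
    by (intro continuous_on_mult continuous_on_of_real bounded_linear.continuous_on[OF bounded_linear_vec_nth]
        continuous_on_compose2[OF continuous_on_wave[of UNIV]] continuous_on_snd continuous_on_id) auto
qed

text \<open>The Weierstrass test with the majorant \<open>lattice_decay\<close> gives uniform
  convergence of the series, hence joint continuity in time and space.\<close>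

lemma continuous_on_neg_lap_inv_sqrt:
  fixes f :: "real^3 \<Rightarrow> real \<Rightarrow> real^3"
  assumes L: "L > 0" and f: "smooth_field L T f"
  shows "continuous_on ({0..T} \<times> UNIV) (\<lambda>z. neg_lap_inv_sqrt L (\<lambda>y. f y (fst z)) (snd z))"
proof -
  define c where "c k = complex_of_real (L / (2 * pi * norm (kvec k)))" for k
  define summand where "summand i k z = c k * fcoef L (\<lambda>y. f y (fst z) $ i) k * cis (2 * pi * (kvec k \<bullet> snd z) / L)"
    for i k and z :: "real \<times> (real^3)"
  have coef: "fcoef L (\<lambda>y. f y s $ i) k = 1 / complex_of_real L ^ 3 * wave_int L (\<lambda>y. f y s $ i) k"
    if "0 \<le> s" "s \<le> T" for s i k
    by (rule fcoef_eq_wave_int) (use pdiff_nth[OF pdiff_field[OF f that]] in \<open>simp add: pdiff_def\<close>)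
  have "continuous_on ({0..T} \<times> UNIV) (\<lambda>z. \<Sum>\<^sub>\<infinity>k\<in>{k. k \<noteq> 0}. summand i k z)" for i
  proof -
    obtain M where M: "\<And>k s. 0 \<le> s \<Longrightarrow> s \<le> T \<Longrightarrow>
        norm (wave_int L (\<lambda>y. f y s $ i) k) \<le> M * lattice_decay ((2 * pi / L)\<^sup>2) k"
      using wave_int_decay[OF L f] by blast
    \<comment> \<open>The factors are the bound on the multiplier, the normalisation of
      \<open>fcoef\<close> and the constant of the decay estimate.\<close>
    let ?C = "L / (2 * pi) * (1 / L ^ 3) * M"
    have "uniform_limit ({0..T} \<times> UNIV) (\<lambda>X z. \<Sum>k\<in>X. summand i k z) (\<lambda>z. \<Sum>\<^sub>\<infinity>k\<in>{k. k \<noteq> 0}. summand i k z)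
        (finite_subsets_at_top {k. k \<noteq> 0})"
    proof (rule Weierstrass_m_test_general)
      show "(\<lambda>k. ?C * lattice_decay ((2 * pi / L)\<^sup>2) k) summable_on {k. k \<noteq> 0}"
        by (intro summable_on_cmult_right summable_on_lattice_decay) (use L in simp)
      fix k :: "int^3" and z :: "real \<times> (real^3)"
      assume k: "k \<in> {k. k \<noteq> 0}" and z: "z \<in> {0..T} \<times> UNIV"
      then have s: "0 \<le> fst z" "fst z \<le> T" by auto
      have n: "1 \<le> norm (kvec k)" using norm_kvec_ge_1 k by simp
      have "norm (c k) \<le> L / (2 * pi)"
      proof -
        have "L / (2 * pi * norm (kvec k)) \<le> L / (2 * pi * 1)"
          using L n by (intro divide_left_mono mult_left_mono mult_pos_pos) auto
        moreover have "norm (c k) = L / (2 * pi * norm (kvec k))"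
          using L by (simp add: c_def del: of_real_divide)
        ultimately show ?thesis by simp
      qed
      then have "norm (c k) * (1 / L ^ 3) * norm (wave_int L (\<lambda>y. f y (fst z) $ i) k)
         \<le> L / (2 * pi) * (1 / L ^ 3) * (M * lattice_decay ((2 * pi / L)\<^sup>2) k)"
        using L M[OF s] by (intro mult_mono) auto
      then show "norm (summand i k z) \<le> ?C * lattice_decay ((2 * pi / L)\<^sup>2) k"
        using L by (simp add: summand_def coef[OF s] norm_mult norm_divide norm_power mult.assoc)
    qed
    moreover have "continuous_on ({0..T} \<times> UNIV) (\<lambda>z. \<Sum>k\<in>X. summand i k z)" for X
    proof (rule continuous_on_sum)
      fix k
      have "continuous_on ({0..T} \<times> UNIV) (\<lambda>z. wave_int L (\<lambda>y. f y (fst z) $ i) k)"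
        by (rule continuous_on_compose2[OF continuous_on_wave_int[OF f]]) (auto intro: continuous_on_fst continuous_on_id)
      then have "continuous_on ({0..T} \<times> UNIV) (\<lambda>z. c k * (1 / complex_of_real L ^ 3 * wave_int L (\<lambda>y. f y (fst z) $ i) k)
          * cis (2 * pi * (kvec k \<bullet> snd z) / L))"
        using L by (intro continuous_on_mult continuous_on_const continuous_on_cis continuous_on_divide continuous_on_inner
            continuous_on_snd continuous_on_id) auto
      then show "continuous_on ({0..T} \<times> UNIV) (summand i k)"
        \<comment> \<open>\<open>coef\<close> is available for times in \<open>{0..T}\<close>, so
          continuity is transferred by equality on that domain.\<close>
        by (rule continuous_on_eq) (auto simp: summand_def coef)
    qed
    ultimately show ?thesis
      by (intro uniform_limit_theorem[where F = "finite_subsets_at_top {k. k \<noteq> 0}"]) auto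
  qed
  then show ?thesis
    unfolding neg_lap_inv_sqrt_def summand_def c_def
    by (intro continuous_on_vec_lambda continuous_on_Re)
qed

section \<open>The four bounds\<close>

lemma sint_slice:
  fixes G :: "real^3 \<Rightarrow> real \<Rightarrow> real"
  assumes G: "continuous_on ({0..T} \<times> cell L) (\<lambda>z. G (snd z) (fst z))" and s: "0 \<le> s" "s \<le> T"
  shows "sint L (\<lambda>x. G x s) = integral (cell L) (\<lambda>x. G x s)"
proof (rule sint_eq_integral)
  have "continuous_on (cell L) (\<lambda>x. (\<lambda>z. G (snd z) (fst z)) (s, x))"
    by (rule continuous_on_compose2[OF G])
      (use s in \<open>auto intro: continuous_on_Pair continuous_on_const continuous_on_id\<close>)
  then show "continuous_on (cell L) (\<lambda>x. G x s)" by simp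
qed

lemma time_integral_sint:
  fixes G :: "real^3 \<Rightarrow> real \<Rightarrow> real"
  assumes G: "continuous_on ({0..T} \<times> cell L) (\<lambda>z. G (snd z) (fst z))" and t: "t \<le> T"
  shows "(LINT s:{0..t}|lborel. sint L (\<lambda>x. G x s)) = integral {0..t} (\<lambda>s. integral (cell L) (\<lambda>x. G x s))"
proof -
  have "(LINT s:{0..t}|lborel. sint L (\<lambda>x. G x s)) = (LINT s:{0..t}|lborel. integral (cell L) (\<lambda>x. G x s))"
    by (rule set_lebesgue_integral_cong) (use sint_slice[OF G] t in auto)
  also have "\<dots> = integral {0..t} (\<lambda>s. integral (cell L) (\<lambda>x. G x s))"
    by (rule time_integral_eq, rule continuous_on_subset[OF continuous_on_cell_integral[OF G]]) (use t in auto)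
  finally show ?thesis .
qed

text \<open>Used for the monotonicity in time of the forcing term in the energy bound and of
  \<open>Uint\<close>.\<close>

lemma integral_upper_limit_mono:
  fixes g :: "real \<Rightarrow> real"
  assumes g: "continuous_on {0..T} g" "\<And>s. 0 \<le> s \<Longrightarrow> s \<le> T \<Longrightarrow> 0 \<le> g s" and st: "s \<le> t" "t \<le> T"
  shows "integral {0..s} g \<le> integral {0..t} g"
proof (rule integral_subset_le)
  show "g integrable_on {0..s}" "g integrable_on {0..t}"
    by (intro integrable_continuous_real continuous_on_subset[OF g(1)]; use st in auto)+
qed (use g st in auto)

lemma cell_integral_nonneg:
  fixes G :: "real^3 \<Rightarrow> real \<Rightarrow> real"
  assumes G: "continuous_on ({0..T} \<times> cell L) (\<lambda>z. G (snd z) (fst z))" and s: "0 \<le> s" "s \<le> T"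
    and nonneg: "\<And>x. 0 \<le> G x s"
  shows "0 \<le> integral (cell L) (\<lambda>x. G x s)"
proof -
  have "0 \<le> sint L (\<lambda>x. G x s)"
    unfolding sint_def set_lebesgue_integral_def by (rule integral_nonneg_AE) (simp add: nonneg)
  then show ?thesis by (simp add: sint_slice[OF G s])
qed

lemma grad_sq_nonneg: "0 \<le> grad_sq T F x t"
  by (simp add: grad_sq_def sum_nonneg)

section \<open>Assembly of the estimates\<close>

context drift_flow
begin

text \<open>The estimates run on unnormalised integrals with \<open>b = L ^ 3 * B\<close>; the
  factor \<open>L ^ 3\<close> is divided out at the end of each.\<close>

lemma drift_flow_bounds:
  assumes f: "smooth_field L T f" and t: "0 < t" "t \<le> T"
    and energy: "\<And>t. 0 \<le> t \<Longrightarrow> t \<le> T \<Longrightarrow>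
       sint L (\<lambda>x. (norm (u x t))\<^sup>2) + \<nu> * (LINT s:{0..t}|lborel. sint L (\<lambda>x. grad_sq T u x s))
       \<le> sint L (\<lambda>x. (norm (u x 0))\<^sup>2)
          + (1 / \<nu>) * (LINT s:{0..t}|lborel. sint L (\<lambda>x. (norm (neg_lap_inv_sqrt L (\<lambda>y. f y s) x))\<^sup>2))"
    and Kinf: "(LINT s:{0..T}|lborel. Linf (\<lambda>x. u x s)) \<le> Kinf"
  defines "E0 \<equiv> (1 / (2 * L ^ 3)) * sint L (\<lambda>x. (norm (u x 0))\<^sup>2)"
    and "epsB \<equiv> (1 / (\<nu> * t)) * (LINT s:{0..t}|lborel.
           (1 / L ^ 3) * sint L (\<lambda>x. (norm (neg_lap_inv_sqrt L (\<lambda>y. f y s) x))\<^sup>2))"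
  defines "B \<equiv> 4 * E0 + t * epsB"
  shows "Linf (\<lambda>x. l x t) \<le> (LINT s:{0..t}|lborel. Linf (\<lambda>x. u x s))"
    and "(LINT s:{0..t}|lborel. Linf (\<lambda>x. u x s)) \<le> Kinf"
    and "(1 / L ^ 3) * sint L (\<lambda>x. (norm (l x t))\<^sup>2) \<le> B * t\<^sup>2"
    and "(1 / (L ^ 3 * t)) * (LINT s:{0..t}|lborel. sint L (\<lambda>x. grad_sq T l x s)) \<le> B * t / (2 * \<nu>)"
    and "sint L (\<lambda>x. grad_sq T l x t) / L ^ 3
           + \<nu> * (LINT s:{0..t}|lborel. sint L (\<lambda>x. (norm (lap T l x s))\<^sup>2) / L ^ 3)
         \<le> 2 * (B * t / \<nu> + Kinf\<^sup>2 * B / \<nu>\<^sup>2)"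
proof -
  have t': "0 \<le> t" using t by simp
  have L3: "L ^ 3 > 0" using pos by simp
  let ?n = "\<lambda>x s. (norm (neg_lap_inv_sqrt L (\<lambda>y. f y s) x))\<^sup>2"
  have cn: "continuous_on ({0..T} \<times> cell L) (\<lambda>z. ?n (snd z) (fst z))"
    by (intro continuous_on_power continuous_on_norm continuous_on_subset[OF continuous_on_neg_lap_inv_sqrt[OF pos(2) f]]) auto
  have cu: "continuous_on ({0..T} \<times> cell L) (\<lambda>z. (norm (u (snd z) (fst z)))\<^sup>2)"
    by (intro continuous_on_power continuous_on_norm smooth_field_continuous[OF u] slice_ranges)
  have cl: "continuous_on ({0..T} \<times> cell L) (\<lambda>z. (norm (l (snd z) (fst z)))\<^sup>2)"
    by (intro continuous_on_power continuous_on_norm smooth_field_continuous[OF l] slice_ranges)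
  have cgu: "continuous_on ({0..T} \<times> cell L) (\<lambda>z. grad_sq T u (snd z) (fst z))"
    by (intro continuous_on_grad_sq_lap(1) u slice_ranges)
  have cgl: "continuous_on ({0..T} \<times> cell L) (\<lambda>z. grad_sq T l (snd z) (fst z))"
    by (intro continuous_on_grad_sq_lap(1) l slice_ranges)
  have cll: "continuous_on ({0..T} \<times> cell L) (\<lambda>z. (norm (lap T l (snd z) (fst z)))\<^sup>2)"
    by (intro continuous_on_power continuous_on_norm continuous_on_grad_sq_lap(2) l slice_ranges)

  define N where "N = (\<lambda>s. CI (\<lambda>x. ?n x s))"
  define e where "e = (\<lambda>s. CI (\<lambda>x. (norm (u x s))\<^sup>2))"
  define gu where "gu = (\<lambda>s. CI (\<lambda>x. grad_sq T u x s))"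
  \<comment> \<open>The factor \<open>2\<close> comes from
    \<open>4 * E0 * L ^ 3 = 2 * e 0\<close>.\<close>
  define b where "b = 2 * e 0 + integral {0..t} N / \<nu>"
  have N_nonneg: "0 \<le> N s" and e_nonneg: "0 \<le> e s" and gu_nonneg: "0 \<le> gu s" if "0 \<le> s" "s \<le> T" for s
    unfolding N_def e_def gu_def
    by (rule cell_integral_nonneg[OF cn that], simp) (rule cell_integral_nonneg[OF cu that], simp,
        rule cell_integral_nonneg[OF cgu that], rule grad_sq_nonneg)
  have cont: "continuous_on {0..T} N" "continuous_on {0..T} e" "continuous_on {0..T} gu"
    unfolding N_def e_def gu_def using cn cu cgu by (auto intro!: continuous_on_cell_integral)
  have B_eq: "B * L ^ 3 = b"
  proof -
    have "4 * E0 * L ^ 3 = 2 * e 0"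
      using L3 sint_slice[OF cu, of 0] pos(3) by (simp add: E0_def e_def)
    moreover have "t * epsB * L ^ 3 = integral {0..t} N / \<nu>"
      using L3 t(1) pos(1) by (simp add: epsB_def N_def time_integral_sint[OF cn t(2)])
    ultimately show ?thesis by (simp add: B_def b_def distrib_right)
  qed
  then have B: "B = b / L ^ 3" using L3 by (simp add: field_simps)
  \<comment> \<open>The bound at time \<open>s\<close> is enlarged to the one at the fixed time
    \<open>t\<close>, with \<open>e 0 \<le> 2 * e 0\<close>, so that one constant \<open>b\<close>
    serves on all of \<open>[0, t]\<close>.\<close>
  have energy': "e s + \<nu> * integral {0..s} gu \<le> b" if s: "0 \<le> s" "s \<le> t" for s
  proof -
    have s': "s \<le> T" using s t by simp
    have "e s + \<nu> * integral {0..s} gu \<le> e 0 + integral {0..s} N / \<nu>"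
      using energy[OF s(1) s'] pos(3)
      by (simp add: e_def gu_def N_def time_integral_sint[OF cn s'] time_integral_sint[OF cgu s']
          sint_slice[OF cu s(1) s'] sint_slice[OF cu, of 0])
    also have "\<dots> \<le> 2 * e 0 + integral {0..t} N / \<nu>"
      using integral_upper_limit_mono[OF cont(1) N_nonneg s(2) t(2)] e_nonneg[of 0] pos
      by (intro add_mono divide_right_mono) auto
    finally show ?thesis by (simp add: b_def)
  qed
  have int_gu_nonneg: "0 \<le> integral {0..s} gu" if "0 \<le> s" "s \<le> t" for s
    by (rule Henstock_Kurzweil_Integration.integral_nonneg)
      (use that t gu_nonneg in \<open>auto intro!: integrable_continuous_real continuous_on_subset[OF cont(3)]\<close>)
  \<comment> \<open>Both terms on the left of \<open>energy'\<close> are nonnegative, so each is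
    bounded by \<open>b\<close> separately.\<close>
  have e_le: "e s \<le> b" if "0 \<le> s" "s \<le> t" for s
    using energy'[OF that] mult_nonneg_nonneg[of \<nu>, OF _ int_gu_nonneg[OF that]] pos(1) by simp
  have int_gu_le: "integral {0..t} gu \<le> b / \<nu>"
    using energy'[OF t' order_refl] e_nonneg[OF t' t(2)] pos(1) by (simp add: pos_le_divide_eq mult.commute)
  have int_e_le: "integral {0..t} e \<le> b * t"
  proof -
    have "integral {0..t} e \<le> integral {0..t} (\<lambda>s. b)"
      by (rule integral_le)
        (use t e_le in \<open>auto intro!: integrable_continuous_real continuous_on_subset[OF cont(2)]\<close>)
    then show ?thesis using t by (simp add: mult.commute)
  qed

  have cLinf: "continuous_on {0..s} (\<lambda>s. Linf (\<lambda>x. u x s))" if "s \<le> T" for s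
    by (rule continuous_on_subset[OF continuous_on_Linf[OF u pos(2)]]) (use that in auto)
  have Uint: "(LINT s:{0..s}|lborel. Linf (\<lambda>x. u x s)) = Uint s" if "s \<le> T" for s
    by (rule time_integral_eq[OF cLinf[OF that]])
  have Uint_mono: "Uint s \<le> Uint r" if "s \<le> r" "r \<le> T" for s r
    by (rule integral_upper_limit_mono[OF continuous_on_Linf[OF u pos(2)] Linf_u_nonneg that])
  show 1: "Linf (\<lambda>x. l x t) \<le> (LINT s:{0..t}|lborel. Linf (\<lambda>x. u x s))"
    unfolding Uint[OF t(2)] by (rule Linf_le) (rule norm_l_le[OF t' t(2)])
  show 2: "(LINT s:{0..t}|lborel. Linf (\<lambda>x. u x s)) \<le> Kinf"
    using Kinf Uint_mono[OF t(2)] unfolding Uint[OF t(2)] Uint[OF order_refl] by simp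
  have l_le: "norm (l x s) \<le> Kinf" if "0 \<le> s" "s \<le> t" for x s
  proof -
    have "norm (l x s) \<le> Uint s" using norm_l_le that t by simp
    also have "\<dots> \<le> Uint t" using Uint_mono that t by simp
    also have "\<dots> \<le> Kinf" using 2 unfolding Uint[OF t(2)] .
    finally show ?thesis .
  qed

  have eb: "CI (\<lambda>x. (norm (l x t))\<^sup>2) + 2 * \<nu> * integral {0..t} (\<lambda>s. CI (\<lambda>x. grad_sq T l x s)) \<le> b * t\<^sup>2"
    by (rule energy_bound[OF t' t(2)]) (use e_le in \<open>simp add: e_def\<close>)
  have gl_nonneg: "0 \<le> integral {0..t} (\<lambda>s. CI (\<lambda>x. grad_sq T l x s))"
    by (rule Henstock_Kurzweil_Integration.integral_nonneg)
      (use t in \<open>auto intro!: integrable_continuous_real continuous_on_subset[OF continuous_on_cell_integral[OF cgl]]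
          cell_integral_nonneg[OF cgl] grad_sq_nonneg\<close>)
  have "CI (\<lambda>x. (norm (l x t))\<^sup>2) \<le> b * t\<^sup>2"
    using eb mult_nonneg_nonneg[OF _ gl_nonneg, of "2 * \<nu>"] pos(1) by linarith
  then show "(1 / L ^ 3) * sint L (\<lambda>x. (norm (l x t))\<^sup>2) \<le> B * t\<^sup>2"
    using divide_right_mono[of _ _ "L ^ 3"] L3 by (simp add: sint_slice[OF cl t' t(2)] B)
  have "0 \<le> CI (\<lambda>x. (norm (l x t))\<^sup>2)" by (rule cell_integral_nonneg[OF cl t' t(2)]) simp
  then have "2 * \<nu> * integral {0..t} (\<lambda>s. CI (\<lambda>x. grad_sq T l x s)) \<le> b * t\<^sup>2"
    using eb by linarith
  then have "2 * \<nu> * integral {0..t} (\<lambda>s. CI (\<lambda>x. grad_sq T l x s)) / (2 * \<nu> * (L ^ 3 * t)) \<le> b * t\<^sup>2 / (2 * \<nu> * (L ^ 3 * t))"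
    by (rule divide_right_mono) (use pos t in simp)
  then show "(1 / (L ^ 3 * t)) * (LINT s:{0..t}|lborel. sint L (\<lambda>x. grad_sq T l x s)) \<le> B * t / (2 * \<nu>)"
    using pos t L3 by (simp add: time_integral_sint[OF cgl t(2)] B power2_eq_square mult_ac)

  \<comment> \<open>The maximum principle enters here, with \<open>Kinf\<close> as the uniform bound
    on \<open>l\<close> up to time \<open>t\<close>.\<close>
  have "CI (\<lambda>x. grad_sq T l x t) + \<nu> * integral {0..t} (\<lambda>s. CI (\<lambda>x. (norm (lap T l x s))\<^sup>2))
      \<le> 2 / \<nu> * (Kinf\<^sup>2 * integral {0..t} gu + integral {0..t} e)"
    unfolding gu_def e_def by (rule gradient_bound[OF t' t(2) l_le])
  also have "\<dots> \<le> 2 / \<nu> * (Kinf\<^sup>2 * (b / \<nu>) + b * t)"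
    using int_gu_le int_e_le pos(1) by (intro mult_left_mono add_mono) auto
  finally have "(CI (\<lambda>x. grad_sq T l x t) + \<nu> * integral {0..t} (\<lambda>s. CI (\<lambda>x. (norm (lap T l x s))\<^sup>2))) / L ^ 3
      \<le> 2 / \<nu> * (Kinf\<^sup>2 * (b / \<nu>) + b * t) / L ^ 3"
    by (rule divide_right_mono) (use L3 in simp)
  also have "\<dots> = 2 * (B * t / \<nu> + Kinf\<^sup>2 * B / \<nu>\<^sup>2)"
    by (simp add: B power2_eq_square distrib_left add_divide_distrib mult_ac)
  finally show "sint L (\<lambda>x. grad_sq T l x t) / L ^ 3
           + \<nu> * (LINT s:{0..t}|lborel. sint L (\<lambda>x. (norm (lap T l x s))\<^sup>2) / L ^ 3)
         \<le> 2 * (B * t / \<nu> + Kinf\<^sup>2 * B / \<nu>\<^sup>2)"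
    by (simp add: sint_slice[OF cgl t' t(2)] time_integral_sint[OF cll t(2)] add_divide_distrib)
qed

end

theorem theorem1:
  shows "\<exists>C::real. C > 0 \<and>
   (\<forall>(\<nu>::real) (L::real) (T::real) (f::real^3 \<Rightarrow> real \<Rightarrow> real^3)
      (u::real^3 \<Rightarrow> real \<Rightarrow> real^3) (l::real^3 \<Rightarrow> real \<Rightarrow> real^3) (Kinf::real).
     \<nu> > 0 \<and> L > 0 \<and> T > 0
     \<and> smooth_on (ST T) (case_prod f) \<and> periodic_field L T f
     \<and> (\<forall>t\<in>{0..T}. sint L (\<lambda>x. f x t) = 0)
     \<and> smooth_on (ST T) (case_prod u) \<and> periodic_field L T u
     \<and> (\<forall>x. \<forall>t\<in>{0..T}. divg T u x t = 0)
     \<and> (\<forall>t\<in>{0..T}.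
          sint L (\<lambda>x. (norm (u x t))\<^sup>2)
            + \<nu> * (LINT s:{0..t}|lborel. sint L (\<lambda>x. grad_sq T u x s))
          \<le> min (2 * sint L (\<lambda>x. (norm (u x 0))\<^sup>2)
                   + 3 * t * (LINT s:{0..t}|lborel. sint L (\<lambda>x. (norm (f x s))\<^sup>2)))
                 (sint L (\<lambda>x. (norm (u x 0))\<^sup>2)
                   + (1 / \<nu>) * (LINT s:{0..t}|lborel.
                        sint L (\<lambda>x. (norm (neg_lap_inv_sqrt L (\<lambda>y. f y s) x))\<^sup>2))))
     \<and> (LINT s:{0..T}|lborel. Linf (\<lambda>x. u x s)) \<le> Kinf
     \<and> smooth_on (ST T) (case_prod l) \<and> periodic_field L T l
     \<and> (\<forall>x. \<forall>t\<in>{0..T}. pt T l x t + adv T u l x t - \<nu> *\<^sub>R lap T l x t + u x t = 0)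
     \<and> (\<forall>x. l x 0 = 0)
     \<longrightarrow>
     (\<forall>t\<in>{0<..T}.
        let E0 = (1 / (2 * L ^ 3)) * sint L (\<lambda>x. (norm (u x 0))\<^sup>2);
            epsB = (1 / (\<nu> * t)) * (LINT s:{0..t}|lborel.
                      (1 / L ^ 3) * sint L (\<lambda>x. (norm (neg_lap_inv_sqrt L (\<lambda>y. f y s) x))\<^sup>2));
            B = 4 * E0 + t * epsB
        in Linf (\<lambda>x. l x t) \<le> (LINT s:{0..t}|lborel. Linf (\<lambda>x. u x s))
         \<and> (LINT s:{0..t}|lborel. Linf (\<lambda>x. u x s)) \<le> Kinf
         \<and> (1 / L ^ 3) * sint L (\<lambda>x. (norm (l x t))\<^sup>2) \<le> (4 * E0 + t * epsB) * t\<^sup>2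
         \<and> (1 / (L ^ 3 * t)) * (LINT s:{0..t}|lborel. sint L (\<lambda>x. grad_sq T l x s))
             \<le> B * t / (2 * \<nu>)
         \<and> sint L (\<lambda>x. grad_sq T l x t) / L ^ 3
             + \<nu> * (LINT s:{0..t}|lborel. sint L (\<lambda>x. (norm (lap T l x s))\<^sup>2) / L ^ 3)
           \<le> C * (B * t / \<nu> + Kinf\<^sup>2 * B / \<nu>\<^sup>2)))"
proof (intro exI[of _ 2] conjI allI impI ballI)
  fix \<nu> L T :: real and f u l :: "real^3 \<Rightarrow> real \<Rightarrow> real^3" and Kinf t :: real
  assume H: "\<nu> > 0 \<and> L > 0 \<and> T > 0
     \<and> smooth_on (ST T) (case_prod f) \<and> periodic_field L T f
     \<and> (\<forall>t\<in>{0..T}. sint L (\<lambda>x. f x t) = 0)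
     \<and> smooth_on (ST T) (case_prod u) \<and> periodic_field L T u
     \<and> (\<forall>x. \<forall>t\<in>{0..T}. divg T u x t = 0)
     \<and> (\<forall>t\<in>{0..T}.
          sint L (\<lambda>x. (norm (u x t))\<^sup>2)
            + \<nu> * (LINT s:{0..t}|lborel. sint L (\<lambda>x. grad_sq T u x s))
          \<le> min (2 * sint L (\<lambda>x. (norm (u x 0))\<^sup>2)
                   + 3 * t * (LINT s:{0..t}|lborel. sint L (\<lambda>x. (norm (f x s))\<^sup>2)))
                 (sint L (\<lambda>x. (norm (u x 0))\<^sup>2)
                   + (1 / \<nu>) * (LINT s:{0..t}|lborel.
                        sint L (\<lambda>x. (norm (neg_lap_inv_sqrt L (\<lambda>y. f y s) x))\<^sup>2))))
     \<and> (LINT s:{0..T}|lborel. Linf (\<lambda>x. u x s)) \<le> Kinf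
     \<and> smooth_on (ST T) (case_prod l) \<and> periodic_field L T l
     \<and> (\<forall>x. \<forall>t\<in>{0..T}. pt T l x t + adv T u l x t - \<nu> *\<^sub>R lap T l x t + u x t = 0)
     \<and> (\<forall>x. l x 0 = 0)"
    and t: "t \<in> {0<..T}"
  interpret drift_flow \<nu> L T u l
    by unfold_locales (use H in \<open>simp_all add: smooth_field_def\<close>)
  have f: "smooth_field L T f" using H by (simp add: smooth_field_def)
  \<comment> \<open>The minimum is bounded by its second entry, the one containing the inverse half
    Laplacian of \<open>f\<close>.\<close>
  have energy: "sint L (\<lambda>x. (norm (u x t))\<^sup>2) + \<nu> * (LINT s:{0..t}|lborel. sint L (\<lambda>x. grad_sq T u x s))
       \<le> sint L (\<lambda>x. (norm (u x 0))\<^sup>2)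
          + (1 / \<nu>) * (LINT s:{0..t}|lborel. sint L (\<lambda>x. (norm (neg_lap_inv_sqrt L (\<lambda>y. f y s) x))\<^sup>2))"
    if "0 \<le> t" "t \<le> T" for t
    using H that unfolding min.bounded_iff by simp
  have Kinf: "(LINT s:{0..T}|lborel. Linf (\<lambda>x. u x s)) \<le> Kinf" using H by blast
  have t': "0 < t" "t \<le> T" using t by auto
  show "let E0 = (1 / (2 * L ^ 3)) * sint L (\<lambda>x. (norm (u x 0))\<^sup>2);
            epsB = (1 / (\<nu> * t)) * (LINT s:{0..t}|lborel.
                      (1 / L ^ 3) * sint L (\<lambda>x. (norm (neg_lap_inv_sqrt L (\<lambda>y. f y s) x))\<^sup>2));
            B = 4 * E0 + t * epsB
        in Linf (\<lambda>x. l x t) \<le> (LINT s:{0..t}|lborel. Linf (\<lambda>x. u x s))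
         \<and> (LINT s:{0..t}|lborel. Linf (\<lambda>x. u x s)) \<le> Kinf
         \<and> (1 / L ^ 3) * sint L (\<lambda>x. (norm (l x t))\<^sup>2) \<le> (4 * E0 + t * epsB) * t\<^sup>2
         \<and> (1 / (L ^ 3 * t)) * (LINT s:{0..t}|lborel. sint L (\<lambda>x. grad_sq T l x s))
             \<le> B * t / (2 * \<nu>)
         \<and> sint L (\<lambda>x. grad_sq T l x t) / L ^ 3
             + \<nu> * (LINT s:{0..t}|lborel. sint L (\<lambda>x. (norm (lap T l x s))\<^sup>2) / L ^ 3)
           \<le> 2 * (B * t / \<nu> + Kinf\<^sup>2 * B / \<nu>\<^sup>2)"
    unfolding Let_def by (intro conjI drift_flow_bounds[OF f t' energy Kinf])
qed simp

end
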